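(* Fix $C>1$ and let $\delta=\delta(C)=C-1-\log C>0$. Fix $M>\frac1\delta$ and $0<\gamma<1$. There exists $\epsilon_1>0$ such that for every $0<\epsilon<\epsilon_1$ there is a positive constant $L_3$ such that, for all $n\ge L_3$, \[ \mathbb{P}(H_2)\ge 1-\gamma, \] where \[ H_2=\Big\{(1-q(C)-\gamma)n\le Y_n(\epsilon)\le(1-q(C)+\gamma)n\Big\}\cap\bigcap_{1\le j\le n}\Big(\{\#\mathcal{E}_j\le M\log n\}\cup\{\#\mathcal{E}_j>\epsilon n\}\Big), \] and $Y_n(\epsilon)=\sum_{i=1}^n\mathbf{1}(\#\mathcal{E}_i>\epsilon n)$.
   Context: Let $C>0$ be a constant and $(\alpha_n)_{n\ge1}$ a sequence of nonnegative reals with $\alpha_n\to0$. For each $n$, consider the complete graph $K_n$ on vertex set $\{1,\dots,n\}$; each edge $e$ of $K_n$ is independently open with probability $p_n(e)$ and closed otherwise, where $\frac{C-\alpha_n}{n}\le p_n(e)\le\frac{C+\alpha_n}{n}$ for every edge $e$. Let $G$ be the resulting random graph of open edges, with probability measure $\mathbb{P}$. For a vertex $i$, $\mathcal{E}_i$ denotes the open component of $G$ containing $i$ (the set of vertices joined to $i$ by a path of open edges, together with $i$ itself), and $\#\mathcal{E}_i$ its number of vertices. $\log$ is the natural logarithm. $T_1=1$ and for $r\ge2$, $T_r$ is the number of labelled trees on $r$ vertices; $q(C)=\sum_{r=1}^\infty \frac{T_rC^{r-1}e^{-Cr}}{(r-1)!}$. *)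

theory Defs
  imports "HOL-Analysis.Analysis"
begin

text \<open>Edges of the complete graph on vertex set V: the 2-element subsets of V.\<close>
definition edges_on :: "nat set \<Rightarrow> nat set set" where
  "edges_on V = {e. e \<subseteq> V \<and> card e = 2}"

text \<open>Edges of K_n on vertex set {1..n}.\<close>
definition Kn_edges :: "nat \<Rightarrow> nat set set" where
  "Kn_edges n = edges_on {1..n}"

text \<open>Adjacency relation induced by a set S of (open) edges.\<close>
definition adj_rel :: "nat set set \<Rightarrow> (nat \<times> nat) set" where
  "adj_rel S = {(a, b). {a, b} \<in> S \<and> a \<noteq> b}"

text \<open>Open component of vertex i: i together with all vertices joined to i by an open path.\<close>
definition component :: "nat set set \<Rightarrow> nat \<Rightarrow> nat set" where
  "component S i = {j. (i, j) \<in> (adj_rel S)\<^sup>*}"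

text \<open>Graph (V,S) is connected: any two vertices of V are joined by a path.\<close>
definition connected_graph :: "nat set \<Rightarrow> nat set set \<Rightarrow> bool" where
  "connected_graph V S = (\<forall>a\<in>V. \<forall>b\<in>V. (a, b) \<in> (adj_rel S)\<^sup>*)"

text \<open>Acyclic: removing any edge disconnects its endpoints (no edge lies on a cycle).\<close>
definition acyclic_graph :: "nat set set \<Rightarrow> bool" where
  "acyclic_graph S = (\<forall>e\<in>S. \<forall>a b. e = {a, b} \<and> a \<noteq> b \<longrightarrow> (a, b) \<notin> (adj_rel (S - {e}))\<^sup>*)"

definition is_tree :: "nat set \<Rightarrow> nat set set \<Rightarrow> bool" where
  "is_tree V S = (S \<subseteq> edges_on V \<and> connected_graph V S \<and> acyclic_graph S)"

text \<open>T r: number of labelled trees on r vertices {1..r} (T 1 = 1 automatically).\<close>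
definition T :: "nat \<Rightarrow> nat" where
  "T r = card {S. is_tree {1..r} S}"

definition q :: "real \<Rightarrow> real" where
  "q C = (\<Sum>r. real (T (Suc r)) * C ^ r * exp (- C * real (Suc r)) / fact r)"

text \<open>Probability of an event H (a predicate on sets of open edges) in the random
  graph on {1..n} where edge e is open independently with probability pe e.\<close>
definition prob_graph :: "nat \<Rightarrow> (nat set \<Rightarrow> real) \<Rightarrow> (nat set set \<Rightarrow> bool) \<Rightarrow> real" where
  "prob_graph n pe H =
     (\<Sum>S\<in>{S. S \<subseteq> Kn_edges n \<and> H S}.
        (\<Prod>e\<in>S. pe e) * (\<Prod>e\<in>Kn_edges n - S. 1 - pe e))"

text \<open>Y_n(eps) = number of vertices i in {1..n} whose component has more than eps*n vertices.\<close>
definition Y :: "nat \<Rightarrow> real \<Rightarrow> nat set set \<Rightarrow> nat" where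
  "Y n \<epsilon> S = card {i\<in>{1..n}. real (card (component S i)) > \<epsilon> * real n}"

definition H2 :: "nat \<Rightarrow> real \<Rightarrow> real \<Rightarrow> real \<Rightarrow> real \<Rightarrow> nat set set \<Rightarrow> bool" where
  "H2 n C \<gamma> M \<epsilon> S =
     ((1 - q C - \<gamma>) * real n \<le> real (Y n \<epsilon> S) \<and> real (Y n \<epsilon> S) \<le> (1 - q C + \<gamma>) * real n \<and>
      (\<forall>j\<in>{1..n}. real (card (component S j)) \<le> M * ln (real n)
                  \<or> real (card (component S j)) > \<epsilon> * real n))"

end

theory Submission
  imports Defs
begin

text \<open>Every connected graph on \<open>r\<close> vertices contains a spanning tree, so a given set of \<open>r\<close>
  vertices is a component with probability at most
  \<open>T r * ((C + \<alpha>) / n) ^ (r - 1) * exp (- (C - \<alpha>) * r * (n - r) / n)\<close>,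
  and for fixed \<open>r\<close> this is asymptotically sharp. Orienting trees towards a root gives
  \<open>T r \<le> r ^ (r - 1)\<close>, and with \<open>r ^ r \<le> exp r * fact r\<close> the expected number of
  vertices in components of size \<open>r \<le> \<epsilon> n\<close> is at most \<open>n * exp (- d * r)\<close> for any
  \<open>d < C - 1 - ln C\<close> once \<open>\<epsilon>\<close> and \<open>\<alpha>\<close> are small. Choosing \<open>d\<close> with \<open>d * M > 1\<close>, a first moment bound
  excludes sizes between \<open>M ln n\<close> and \<open>\<epsilon> n\<close>, and shows that few vertices lie in components
  of size between a large constant \<open>K\<close> and \<open>\<epsilon> n\<close>. The number of vertices in components of size
  at most \<open>K\<close> has variance \<open>o(n\<^sup>2)\<close>, because disjoint vertex sets are nearly independently
  components, and mean close to \<open>q C * n\<close>. All other vertices are counted by \<open>Y\<close>.\<close>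

section \<open>Expectation over random edge sets\<close>

text \<open>The product measure on \<open>Pow E\<close>. The ground set is a parameter so that the
  same notation serves for sub-families of the edges, where independence becomes a product
  formula.\<close>

definition weight :: "'e set \<Rightarrow> ('e \<Rightarrow> real) \<Rightarrow> 'e set \<Rightarrow> real" where
  "weight E p S = (\<Prod>e\<in>S. p e) * (\<Prod>e\<in>E - S. 1 - p e)"

definition expct :: "'e set \<Rightarrow> ('e \<Rightarrow> real) \<Rightarrow> ('e set \<Rightarrow> real) \<Rightarrow> real" where
  "expct E p f = (\<Sum>S\<in>Pow E. weight E p S * f S)"

lemma finite_edges_on: "finite V \<Longrightarrow> finite (edges_on V)"
  by (rule finite_subset[of _ "Pow V"]) (auto simp: edges_on_def)

lemma finite_Kn_edges: "finite (Kn_edges n)"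
  by (simp add: Kn_edges_def finite_edges_on)

lemma prob_graph_eq_expct:
  "prob_graph n p H = expct (Kn_edges n) p (\<lambda>S. of_bool (H S))"
proof -
  have "expct (Kn_edges n) p (\<lambda>S. of_bool (H S)) =
    (\<Sum>S\<in>{S \<in> Pow (Kn_edges n). H S}. weight (Kn_edges n) p S)"
    unfolding expct_def using finite_Kn_edges[of n]
    by (intro sum.mono_neutral_cong_right) auto
  then show ?thesis unfolding prob_graph_def weight_def by (simp add: Pow_def)
qed

section \<open>Linearity, monotonicity and independence for the expectation\<close>

lemma expct_add: "expct E p (\<lambda>S. f S + g S) = expct E p f + expct E p g"
  by (simp add: expct_def distrib_left sum.distrib)

lemma expct_diff: "expct E p (\<lambda>S. f S - g S) = expct E p f - expct E p g"
  by (simp add: expct_def right_diff_distrib sum_subtractf)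

lemma expct_cmult: "expct E p (\<lambda>S. c * f S) = c * expct E p f"
  by (simp add: expct_def sum_distrib_left mult.left_commute)

lemma expct_sum: "expct E p (\<lambda>S. \<Sum>i\<in>I. f i S) = (\<Sum>i\<in>I. expct E p (f i))"
  unfolding expct_def sum_distrib_left by (rule sum.swap)

lemma expct_cong: "(\<And>S. S \<subseteq> E \<Longrightarrow> f S = g S) \<Longrightarrow> expct E p f = expct E p g"
  by (auto simp: expct_def intro!: sum.cong)

lemma weight_nonneg:
  assumes "\<And>e. e \<in> E \<Longrightarrow> 0 \<le> p e \<and> p e \<le> 1" "S \<subseteq> E"
  shows "0 \<le> weight E p S"
  using assms unfolding weight_def by (intro mult_nonneg_nonneg prod_nonneg) auto

lemma expct_mono:
  assumes "\<And>e. e \<in> E \<Longrightarrow> 0 \<le> p e \<and> p e \<le> 1" "\<And>S. S \<subseteq> E \<Longrightarrow> f S \<le> g S"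
  shows "expct E p f \<le> expct E p g"
  unfolding expct_def using assms by (auto intro!: sum_mono mult_left_mono weight_nonneg)

text \<open>Independence of disjoint edge families: \<open>S\<close> corresponds to the pair
  \<open>(S \<inter> A, S \<inter> B)\<close>, and the weight factorises along this
  bijection.\<close>

lemma expct_split:
  assumes "finite A" "finite B" "A \<inter> B = {}"
  shows "expct (A \<union> B) p (\<lambda>S. f (S \<inter> A) * g (S \<inter> B)) = expct A p f * expct B p g"
proof -
  have w: "weight (A \<union> B) p (X \<union> Y) = weight A p X * weight B p Y" if "X \<subseteq> A" "Y \<subseteq> B" for X Y
  proof -
    have fin: "finite X" "finite Y" using that assms by (auto intro: finite_subset)
    have *: "A \<union> B - (X \<union> Y) = (A - X) \<union> (B - Y)" using that assms(3) by auto
    have "(\<Prod>e\<in>X \<union> Y. p e) = prod p X * prod p Y"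
      using that assms fin by (intro prod.union_disjoint) auto
    moreover have "(\<Prod>e\<in>A \<union> B - (X \<union> Y). 1 - p e) = (\<Prod>e\<in>A - X. 1 - p e) * (\<Prod>e\<in>B - Y. 1 - p e)"
      unfolding * using that assms by (intro prod.union_disjoint) auto
    ultimately show ?thesis by (simp add: weight_def)
  qed
  have "expct A p f * expct B p g =
    (\<Sum>(X, Y)\<in>Pow A \<times> Pow B. (weight A p X * f X) * (weight B p Y * g Y))"
    by (simp add: expct_def sum_product sum.cartesian_product)
  also have "\<dots> = expct (A \<union> B) p (\<lambda>S. f (S \<inter> A) * g (S \<inter> B))"
    unfolding expct_def
  proof (rule sum.reindex_bij_witness[of _ "\<lambda>S. (S \<inter> A, S \<inter> B)" "\<lambda>(X, Y). X \<union> Y"])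
    fix z assume "z \<in> Pow A \<times> Pow B"
    then obtain X Y where z: "z = (X, Y)" "X \<subseteq> A" "Y \<subseteq> B" by auto
    have [simp]: "(X \<union> Y) \<inter> A = X" "(X \<union> Y) \<inter> B = Y" using z assms(3) by auto
    show "weight (A \<union> B) p (case z of (X, Y) \<Rightarrow> X \<union> Y) *
        (f ((case z of (X, Y) \<Rightarrow> X \<union> Y) \<inter> A) * g ((case z of (X, Y) \<Rightarrow> X \<union> Y) \<inter> B)) =
        (case z of (X, Y) \<Rightarrow> weight A p X * f X * (weight B p Y * g Y))"
      using z w[of X Y] by simp
  qed (use assms(3) in auto)
  finally show ?thesis ..
qed

lemma expct_of_bool_eq:
  assumes "finite E" "t \<subseteq> E"
  shows "expct E p (\<lambda>S. of_bool (S = t)) = weight E p t"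
proof -
  have "expct E p (\<lambda>S. of_bool (S = t)) = (\<Sum>S\<in>Pow E. if S = t then weight E p S else 0)"
    unfolding expct_def by (intro sum.cong) auto
  also have "\<dots> = weight E p t" using assms by (subst sum.delta) auto
  finally show ?thesis .
qed

text \<open>Adding one edge \<open>e\<close> multiplies the total mass by
  \<open>(1 - p e) + p e = 1\<close>.\<close>

lemma expct_one:
  assumes "finite E"
  shows "expct E p (\<lambda>S. 1) = 1"
  using assms
proof (induction E)
  case empty
  then show ?case by (simp add: expct_def weight_def)
next
  case (insert e E)
  have "Pow {e} = {{}, {e}}" by auto
  then have "expct {e} p (\<lambda>S. 1) = 1" by (simp add: expct_def weight_def)
  then show ?case
    using expct_split[of "{e}" E p "\<lambda>S. 1" "\<lambda>S. 1"] insert by simp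
qed

text \<open>Edges outside \<open>A\<close> are integrated out: in the splitting of \<open>E\<close>
  into \<open>A\<close> and \<open>E - A\<close> the second factor is the total mass 1.\<close>

lemma expct_restrict:
  assumes "finite E" "A \<subseteq> E"
  shows "expct E p (\<lambda>S. f (S \<inter> A)) = expct A p f"
proof -
  have "A \<union> (E - A) = E" "finite A" using assms finite_subset by auto
  then show ?thesis
    using expct_split[of A "E - A" p f "\<lambda>S. 1"] assms expct_one[of "E - A" p] by auto
qed

lemma expct_superset:
  assumes "finite E" "F \<subseteq> E"
  shows "expct E p (\<lambda>S. of_bool (F \<subseteq> S)) = prod p F"
proof -
  have "finite F" using assms finite_subset by auto
  have "expct E p (\<lambda>S. of_bool (F \<subseteq> S)) = expct E p (\<lambda>S. of_bool (S \<inter> F = F))"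
    by (intro expct_cong) (auto intro!: arg_cong[where f = of_bool])
  also have "\<dots> = weight F p F"
    using expct_restrict[OF assms, of p "\<lambda>S. of_bool (S = F)"] expct_of_bool_eq[OF \<open>finite F\<close>] by simp
  finally show ?thesis by (simp add: weight_def)
qed

section \<open>Spanning trees\<close>

lemma edges_on_iff: "{a, b} \<in> edges_on V \<longleftrightarrow> a \<in> V \<and> b \<in> V \<and> a \<noteq> b"
  by (auto simp: edges_on_def card_insert_if)

lemma edges_onE:
  assumes "e \<in> edges_on V"
  obtains a b where "e = {a, b}" "a \<in> V" "b \<in> V" "a \<noteq> b"
  using assms unfolding edges_on_def by (auto simp: card_2_iff)

lemma sym_adj_rel: "sym (adj_rel S)"
  by (auto simp: sym_def adj_rel_def insert_commute)

lemma adj_rtrancl_sym: "(a, b) \<in> (adj_rel S)\<^sup>* \<Longrightarrow> (b, a) \<in> (adj_rel S)\<^sup>*"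
  by (meson sym_adj_rel sym_rtrancl symD)

lemma adj_rtrancl_mono: "S \<subseteq> S' \<Longrightarrow> (a, b) \<in> (adj_rel S)\<^sup>* \<Longrightarrow> (a, b) \<in> (adj_rel S')\<^sup>*"
  by (erule rtrancl_mono[THEN subsetD, rotated]) (auto simp: adj_rel_def)

lemma connected_graphI_root:
  assumes "\<And>v. v \<in> V \<Longrightarrow> (x, v) \<in> (adj_rel S)\<^sup>*"
  shows "connected_graph V S"
  unfolding connected_graph_def by (meson adj_rtrancl_sym assms rtrancl_trans)

text \<open>The parent of a vertex is a neighbour at smaller distance from the root \<open>x\<close>.\<close>
lemma connected_graph_parents:
  assumes conn: "connected_graph V S" and S: "S \<subseteq> edges_on V" and x: "x \<in> V"
  obtains f where "f \<in> (V - {x}) \<rightarrow>\<^sub>E V" "inj_on (\<lambda>v. {v, f v}) (V - {x})"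
    "(\<lambda>v. {v, f v}) ` (V - {x}) \<subseteq> S" "connected_graph V ((\<lambda>v. {v, f v}) ` (V - {x}))"
proof -
  define R where "R = adj_rel S"
  \<comment> \<open>The graph distance from the root; \<open>LEAST\<close> is meaningful because
    every vertex of \<open>V\<close> is reachable from \<open>x\<close>.\<close>
  define d where "d v = (LEAST k. (x, v) \<in> R ^^ k)" for v
  have reach: "(x, v) \<in> R ^^ d v" if "v \<in> V" for v
  proof -
    have "(x, v) \<in> R\<^sup>*" using conn x that by (auto simp: connected_graph_def R_def)
    then obtain k where "(x, v) \<in> R ^^ k" using rtrancl_imp_relpow by blast
    then show ?thesis unfolding d_def by (rule LeastI)
  qed
  have ex: "\<exists>u. (u, v) \<in> R \<and> d u < d v" if v: "v \<in> V - {x}" for v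
  proof -
    obtain k where k: "d v = Suc k" using reach[of v] v by (cases "d v") auto
    then obtain u where u: "(x, u) \<in> R ^^ k" "(u, v) \<in> R" using reach[of v] v by auto
    have "d u \<le> k" unfolding d_def using u(1) by (rule Least_le)
    then show ?thesis using u k by auto
  qed
  \<comment> \<open>Restricting to \<open>V - {x}\<close> makes \<open>f\<close> an element of an
    extensional function space, which is finite and can be counted.\<close>
  define f where "f = restrict (\<lambda>v. SOME u. (u, v) \<in> R \<and> d u < d v) (V - {x})"
  have f: "(f v, v) \<in> R" "d (f v) < d v" if "v \<in> V - {x}" for v
    using someI_ex[OF ex[OF that]] that by (auto simp: f_def)
  have fS: "{v, f v} \<in> S" if "v \<in> V - {x}" for v
    using f(1)[OF that] by (auto simp: R_def adj_rel_def insert_commute)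
  have fV: "f v \<in> V" if "v \<in> V - {x}" for v
    using fS[OF that] S edges_on_iff by blast
  \<comment> \<open>Induction on the distance: following parents strictly decreases it and so ends
    at the root.\<close>
  have path: "v \<in> V \<Longrightarrow> (x, v) \<in> (adj_rel ((\<lambda>v. {v, f v}) ` (V - {x})))\<^sup>*" for v
  proof (induction "d v" arbitrary: v rule: less_induct)
    case less
    show ?case
    proof (cases "v = x")
      case False
      then have v: "v \<in> V - {x}" using less by auto
      have "(f v, v) \<in> adj_rel ((\<lambda>v. {v, f v}) ` (V - {x}))"
        using v f[OF v] by (auto simp: adj_rel_def R_def)
      then show ?thesis using less(1)[OF f(2)[OF v] fV[OF v]] by simp
    qed simp
  qed
  show ?thesis
  proof (rule that)
    show "f \<in> (V - {x}) \<rightarrow>\<^sub>E V" using fV by (auto simp: f_def)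
    show "inj_on (\<lambda>v. {v, f v}) (V - {x})"
    proof (rule inj_onI)
      fix v w assume vw: "v \<in> V - {x}" "w \<in> V - {x}" "{v, f v} = {w, f w}"
      \<comment> \<open>Otherwise each of \<open>v\<close> and \<open>w\<close> would be the parent
        of the other, and each would be strictly closer to the root.\<close>
      show "v = w"
        using f(2)[OF vw(1)] f(2)[OF vw(2)] vw(3) by (auto simp: doubleton_eq_iff)
    qed
    show "(\<lambda>v. {v, f v}) ` (V - {x}) \<subseteq> S" using fS by blast
    show "connected_graph V ((\<lambda>v. {v, f v}) ` (V - {x}))"
      using path by (rule connected_graphI_root)
  qed
qed

text \<open>The parent edges of the non-root vertices are \<open>card V - 1\<close> distinct edges
  of the graph.\<close>

lemma connected_graph_card:
  assumes "connected_graph V S" "S \<subseteq> edges_on V" "finite V"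
  shows "card V - 1 \<le> card S"
proof (cases "V = {}")
  case False
  then obtain x where x: "x \<in> V" by auto
  obtain f where f: "f \<in> (V - {x}) \<rightarrow>\<^sub>E V" "inj_on (\<lambda>v. {v, f v}) (V - {x})"
    "(\<lambda>v. {v, f v}) ` (V - {x}) \<subseteq> S" "connected_graph V ((\<lambda>v. {v, f v}) ` (V - {x}))"
    by (rule connected_graph_parents[OF assms(1,2) x])
  have "finite S" using assms finite_edges_on finite_subset by blast
  then have "card (V - {x}) \<le> card S" using card_mono[OF _ f(3)] card_image[OF f(2)] by simp
  then show ?thesis using x assms by simp
qed simp

text \<open>The parent edges already connect \<open>V\<close>, so any further edge would lie on a
  cycle. A tree is therefore determined by its parent function.\<close>

lemma tree_parents:
  assumes tree: "is_tree V S" and x: "x \<in> V"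
  obtains f where "f \<in> (V - {x}) \<rightarrow>\<^sub>E V" "inj_on (\<lambda>v. {v, f v}) (V - {x})"
    "S = (\<lambda>v. {v, f v}) ` (V - {x})"
proof -
  have S: "S \<subseteq> edges_on V" and conn: "connected_graph V S" using tree by (simp_all add: is_tree_def)
  obtain f where f: "f \<in> (V - {x}) \<rightarrow>\<^sub>E V" "inj_on (\<lambda>v. {v, f v}) (V - {x})"
    "(\<lambda>v. {v, f v}) ` (V - {x}) \<subseteq> S" "connected_graph V ((\<lambda>v. {v, f v}) ` (V - {x}))"
    by (rule connected_graph_parents[OF conn S x])
  have "S \<subseteq> (\<lambda>v. {v, f v}) ` (V - {x})"
  proof (rule ccontr)
    assume "\<not> ?thesis"
    then obtain e where e: "e \<in> S" "e \<notin> (\<lambda>v. {v, f v}) ` (V - {x})" by blast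
    obtain a b where ab: "e = {a, b}" "a \<in> V" "b \<in> V" "a \<noteq> b"
      using e S edges_onE by blast
    have "(a, b) \<in> (adj_rel ((\<lambda>v. {v, f v}) ` (V - {x})))\<^sup>*"
      using f(4) ab by (simp add: connected_graph_def)
    then have "(a, b) \<in> (adj_rel (S - {e}))\<^sup>*"
      using f(3) e by (intro adj_rtrancl_mono[of "(\<lambda>v. {v, f v}) ` (V - {x})" "S - {e}"]) auto
    then show False using tree e ab by (auto simp: is_tree_def acyclic_graph_def)
  qed
  then show ?thesis using that f by blast
qed

text \<open>If a connected graph with \<open>card V - 1\<close> edges had an edge on a cycle,
  deleting that edge would leave it connected with fewer edges than
  \<open>connected_graph_card\<close> permits.\<close>

lemma is_tree_iff_card:
  assumes "finite V" "V \<noteq> {}"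
  shows "is_tree V S \<longleftrightarrow> S \<subseteq> edges_on V \<and> connected_graph V S \<and> card S = card V - 1"
proof
  assume tree: "is_tree V S"
  obtain x where x: "x \<in> V" using assms by auto
  obtain f where "f \<in> (V - {x}) \<rightarrow>\<^sub>E V" "inj_on (\<lambda>v. {v, f v}) (V - {x})"
    "S = (\<lambda>v. {v, f v}) ` (V - {x})"
    by (rule tree_parents[OF tree x])
  then have "card S = card (V - {x})" by (simp add: card_image)
  then show "S \<subseteq> edges_on V \<and> connected_graph V S \<and> card S = card V - 1"
    using tree x assms by (simp add: is_tree_def)
next
  assume A: "S \<subseteq> edges_on V \<and> connected_graph V S \<and> card S = card V - 1"
  have finS: "finite S" using A assms finite_edges_on finite_subset by blast
  have "acyclic_graph S"
    unfolding acyclic_graph_def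
  proof (intro ballI allI impI notI)
    fix e a b assume e: "e \<in> S" "e = {a, b} \<and> a \<noteq> b" and ab: "(a, b) \<in> (adj_rel (S - {e}))\<^sup>*"
    \<comment> \<open>Every use of the deleted edge is replaced by the detour from \<open>a\<close>
      to \<open>b\<close>.\<close>
    have "adj_rel S \<subseteq> (adj_rel (S - {e}))\<^sup>*"
    proof
      fix z assume "z \<in> adj_rel S"
      then obtain u v where z: "z = (u, v)" "{u, v} \<in> S" "u \<noteq> v" by (auto simp: adj_rel_def)
      show "z \<in> (adj_rel (S - {e}))\<^sup>*"
      proof (cases "{u, v} = e")
        case True
        then show ?thesis using z e ab adj_rtrancl_sym[OF ab] by (auto simp: doubleton_eq_iff)
      next
        case False
        then show ?thesis using z by (intro r_into_rtrancl) (auto simp: adj_rel_def)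
      qed
    qed
    then have "(adj_rel S)\<^sup>* \<subseteq> (adj_rel (S - {e}))\<^sup>*" by (metis rtrancl_mono rtrancl_idemp)
    then have "connected_graph V (S - {e})" using A by (auto simp: connected_graph_def)
    then have "card V - 1 \<le> card (S - {e})" using A assms by (intro connected_graph_card) auto
    moreover have "card (S - {e}) < card S" using e finS by (intro psubset_card_mono) auto
    ultimately show False using A by simp
  qed
  then show "is_tree V S" using A by (simp add: is_tree_def)
qed

text \<open>The parent edges connect \<open>V\<close> and have the right number, hence form a
  spanning tree.\<close>

lemma connected_graph_contains_tree:
  assumes "connected_graph V S" "S \<subseteq> edges_on V" "finite V" "V \<noteq> {}"
  obtains t where "is_tree V t" "t \<subseteq> S"
proof -
  obtain x where x: "x \<in> V" using assms by auto
  obtain f where f: "f \<in> (V - {x}) \<rightarrow>\<^sub>E V" "inj_on (\<lambda>v. {v, f v}) (V - {x})"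
    "(\<lambda>v. {v, f v}) ` (V - {x}) \<subseteq> S" "connected_graph V ((\<lambda>v. {v, f v}) ` (V - {x}))"
    by (rule connected_graph_parents[OF assms(1,2) x])
  then have "is_tree V ((\<lambda>v. {v, f v}) ` (V - {x}))"
    using assms x by (subst is_tree_iff_card) (auto simp: card_image)
  then show ?thesis using that f by blast
qed

section \<open>Counting labelled trees\<close>

lemma finite_trees: "finite V \<Longrightarrow> finite {S. is_tree V S}"
  by (rule finite_subset[of _ "Pow (edges_on V)"]) (auto simp: is_tree_def finite_edges_on)

text \<open>Trees are images of parent functions from \<open>V - {x}\<close> to \<open>V\<close>,
  and the bound is the number of such functions.\<close>

lemma card_trees_le:
  assumes "finite V" "V \<noteq> {}"
  shows "card {S. is_tree V S} \<le> card V ^ (card V - 1)"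
proof -
  obtain x where x: "x \<in> V" using assms by auto
  have fin: "finite ((V - {x}) \<rightarrow>\<^sub>E V)" using assms by (intro finite_PiE) auto
  have "{S. is_tree V S} \<subseteq> (\<lambda>f. (\<lambda>v. {v, f v}) ` (V - {x})) ` ((V - {x}) \<rightarrow>\<^sub>E V)"
  proof
    fix S assume "S \<in> {S. is_tree V S}"
    then have "is_tree V S" by simp
    then obtain f where "f \<in> (V - {x}) \<rightarrow>\<^sub>E V" "inj_on (\<lambda>v. {v, f v}) (V - {x})"
      "S = (\<lambda>v. {v, f v}) ` (V - {x})"
      by (rule tree_parents[OF _ x])
    then show "S \<in> (\<lambda>f. (\<lambda>v. {v, f v}) ` (V - {x})) ` ((V - {x}) \<rightarrow>\<^sub>E V)" by (intro image_eqI)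
  qed
  then have "card {S. is_tree V S} \<le> card ((V - {x}) \<rightarrow>\<^sub>E V)"
    using fin surj_card_le by blast
  also have "\<dots> = card V ^ (card V - 1)" using assms x by (subst card_PiE) auto
  finally show ?thesis .
qed

text \<open>Through the edge-count characterisation only connectedness and cardinality have to be
  carried along \<open>f\<close>, and acyclicity follows.\<close>

lemma is_tree_image:
  assumes "inj_on f V" "is_tree V S" "finite V" "V \<noteq> {}"
  shows "is_tree (f ` V) ((`) f ` S)"
proof -
  have S: "S \<subseteq> edges_on V" "connected_graph V S" "card S = card V - 1"
    using assms is_tree_iff_card by auto
  have img: "(`) f ` S \<subseteq> edges_on (f ` V)"
  proof
    fix e assume "e \<in> (`) f ` S"
    then obtain e' where e': "e = f ` e'" "e' \<in> edges_on V" using S(1) by blast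
    then obtain a b where "e' = {a, b}" "a \<in> V" "b \<in> V" "a \<noteq> b" using edges_onE by blast
    then have "e = {f a, f b}" "a \<in> V" "b \<in> V" "a \<noteq> b" using e' by auto
    then show "e \<in> edges_on (f ` V)" using assms(1) by (auto simp: edges_on_iff inj_on_def)
  qed
  have path: "(f a, f b) \<in> (adj_rel ((`) f ` S))\<^sup>*" if "(a, b) \<in> (adj_rel S)\<^sup>*" for a b
    using that
  proof (induction rule: rtrancl_induct)
    case (step y z)
    then have yz: "{y, z} \<in> S" "y \<noteq> z" by (auto simp: adj_rel_def)
    then have "y \<in> V" "z \<in> V" using S(1) edges_on_iff by blast+
    then have "f y \<noteq> f z" using assms(1) yz by (auto simp: inj_on_def)
    moreover have "{f y, f z} \<in> (`) f ` S" using yz(1) by (force intro: image_eqI[of _ _ "{y, z}"])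
    ultimately have "(f y, f z) \<in> adj_rel ((`) f ` S)" by (simp add: adj_rel_def)
    then show ?case using step by simp
  qed simp
  have "connected_graph (f ` V) ((`) f ` S)"
    using S(2) path by (auto simp: connected_graph_def)
  moreover have "inj_on ((`) f) S"
    using S(1) assms(1) by (intro inj_on_subset[OF inj_on_image_Pow[OF assms(1)]]) (auto simp: edges_on_def)
  then have "card ((`) f ` S) = card (f ` V) - 1" using S(3) assms(1) by (simp add: card_image)
  ultimately show ?thesis using assms img by (subst is_tree_iff_card) auto
qed

lemma card_trees_mono:
  assumes "finite V" "V \<noteq> {}" "finite W" "card V = card W"
  shows "card {S. is_tree V S} \<le> card {S. is_tree W S}"
proof -
  obtain f where f: "bij_betw f V W" using assms finite_same_card_bij by metis
  have inj: "inj_on ((`) ((`) f)) {S. is_tree V S}"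
  proof (rule inj_on_subset[OF inj_on_image_Pow[OF inj_on_image_Pow]])
    show "inj_on f V" using f by (simp add: bij_betw_def)
    show "{S. is_tree V S} \<subseteq> Pow (Pow V)" by (auto simp: is_tree_def edges_on_def)
  qed
  have "(`) ((`) f) ` {S. is_tree V S} \<subseteq> {S. is_tree W S}"
    using is_tree_image[of f V] f assms by (auto simp: bij_betw_def)
  then show ?thesis using card_inj_on_le[OF inj _ finite_trees[OF assms(3)]] by blast
qed

lemma card_trees:
  assumes "finite V" "V \<noteq> {}"
  shows "card {S. is_tree V S} = T (card V)"
proof -
  have "{1..card V} \<noteq> {}" using assms by (simp add: card_gt_0_iff Suc_leI)
  then show ?thesis unfolding T_def
    using assms by (intro antisym card_trees_mono) auto
qed

lemma T_le: "T r \<le> r ^ (r - 1)"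
proof (cases "r = 0")
  case True
  \<comment> \<open>For \<open>r = 0\<close> truncated subtraction turns the bound into
    \<open>0 ^ 0 = 1\<close>, and the empty edge set is the only tree.\<close>
  have "{S. is_tree {} S} = {{}}"
    by (auto simp: is_tree_def edges_on_def connected_graph_def acyclic_graph_def)
  then show ?thesis using True by (simp add: T_def)
next
  case False
  then show ?thesis using card_trees_le[of "{1..r}"] by (simp add: T_def)
qed

section \<open>Components\<close>

definition components :: "nat \<Rightarrow> nat set set \<Rightarrow> nat set set" where
  "components n S = component S ` {1..n}"

definition boundary :: "nat \<Rightarrow> nat set \<Rightarrow> nat set set" where
  "boundary n V = {e \<in> Kn_edges n. e \<inter> V \<noteq> {} \<and> \<not> e \<subseteq> V}"

lemma boundary_edgeE:
  assumes "e \<in> boundary n V"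
  obtains a b where "e = {a, b}" "a \<in> {1..n}" "b \<in> {1..n}" "a \<noteq> b"
proof -
  have "e \<in> edges_on {1..n}" using assms by (simp add: boundary_def Kn_edges_def)
  then show ?thesis using that by (rule edges_onE)
qed

text \<open>\<open>R\<close> is a set of sizes, so that one notion covers a single size, the sizes
  up to \<open>K\<close>, and the intermediate windows.\<close>

definition card_in :: "nat \<Rightarrow> nat set \<Rightarrow> nat set set \<Rightarrow> nat" where
  "card_in n R S = card {i \<in> {1..n}. card (component S i) \<in> R}"

definition vsets :: "nat \<Rightarrow> nat set \<Rightarrow> nat set set" where
  "vsets n R = {V. V \<subseteq> {1..n} \<and> V \<noteq> {} \<and> card V \<in> R}"

lemma finite_vsets: "finite (vsets n R)"
  by (rule finite_subset[of _ "Pow {1..n}"]) (auto simp: vsets_def)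

lemma vsets_finite: "V \<in> vsets n R \<Longrightarrow> finite V"
  by (auto simp: vsets_def intro: finite_subset)

lemma self_in_component: "i \<in> component S i"
  by (simp add: component_def)

lemma component_eqI:
  assumes "j \<in> component S i"
  shows "component S j = component S i"
  using assms adj_rtrancl_sym[of i j S] by (auto simp: component_def intro: rtrancl_trans)

lemma component_subset:
  assumes "S \<subseteq> Kn_edges n" "i \<in> {1..n}"
  shows "component S i \<subseteq> {1..n}"
proof
  fix j assume "j \<in> component S i"
  then have "(i, j) \<in> (adj_rel S)\<^sup>*" by (simp add: component_def)
  then show "j \<in> {1..n}"
  proof (induction rule: rtrancl_induct)
    case (step y z)
    then have "{y, z} \<in> edges_on {1..n}" using assms by (auto simp: adj_rel_def Kn_edges_def)
    then show ?case by (simp add: edges_on_iff)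
  qed (use assms in simp)
qed

text \<open>Splits the event into conditions on two disjoint edge families: those inside
  \<open>V\<close> and those leaving \<open>V\<close>. A path that starts in \<open>V\<close> cannot
  leave it when all edges of the cut are closed.\<close>

lemma components_iff:
  assumes S: "S \<subseteq> Kn_edges n" and V: "V \<subseteq> {1..n}" "V \<noteq> {}"
  shows "V \<in> components n S \<longleftrightarrow> connected_graph V (S \<inter> edges_on V) \<and> S \<inter> boundary n V = {}"
proof
  assume "V \<in> components n S"
  then obtain i where i: "i \<in> {1..n}" "V = component S i" by (auto simp: components_def)
  have closed: "z \<in> V" if "y \<in> V" "{y, z} \<in> S" "y \<noteq> z" for y z
  proof -
    have "(y, z) \<in> adj_rel S" using that by (simp add: adj_rel_def)
    then show ?thesis using that(1) i by (auto simp: component_def)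
  qed
  have "(i, j) \<in> (adj_rel (S \<inter> edges_on V))\<^sup>*" if "j \<in> V" for j
  proof -
    have "(i, j) \<in> (adj_rel S)\<^sup>*" using that i by (simp add: component_def)
    then have "j \<in> V \<and> (i, j) \<in> (adj_rel (S \<inter> edges_on V))\<^sup>*"
    proof (induction rule: rtrancl_induct)
      case base
      show ?case using i by (simp add: self_in_component)
    next
      case (step y z)
      then have yz: "{y, z} \<in> S" "y \<noteq> z" by (auto simp: adj_rel_def)
      have "z \<in> V" using closed[OF _ yz] step by simp
      then have "(y, z) \<in> adj_rel (S \<inter> edges_on V)"
        using yz step by (auto simp: adj_rel_def edges_on_iff)
      then show ?case using \<open>z \<in> V\<close> step by (auto intro: rtrancl_into_rtrancl)
    qed
    then show ?thesis by simp
  qed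
  then have "connected_graph V (S \<inter> edges_on V)" by (rule connected_graphI_root)
  moreover have "S \<inter> boundary n V = {}"
  proof (rule ccontr)
    assume "S \<inter> boundary n V \<noteq> {}"
    then obtain e where e: "e \<in> S" "e \<in> boundary n V" by auto
    then obtain a b where "e = {a, b}" "a \<noteq> b" by (metis boundary_edgeE)
    then show False using e closed[of a b] closed[of b a] by (auto simp: boundary_def insert_commute)
  qed
  ultimately show "connected_graph V (S \<inter> edges_on V) \<and> S \<inter> boundary n V = {}" by simp
next
  assume A: "connected_graph V (S \<inter> edges_on V) \<and> S \<inter> boundary n V = {}"
  obtain i where i: "i \<in> V" using V by auto
  have "component S i = V"
  proof (intro equalityI subsetI)
    fix j assume "j \<in> V"
    then have "(i, j) \<in> (adj_rel (S \<inter> edges_on V))\<^sup>*" using A i by (simp add: connected_graph_def)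
    then show "j \<in> component S i"
      using adj_rtrancl_mono[of "S \<inter> edges_on V" S] by (simp add: component_def)
  next
    fix j assume "j \<in> component S i"
    then have "(i, j) \<in> (adj_rel S)\<^sup>*" by (simp add: component_def)
    then show "j \<in> V"
    proof (induction rule: rtrancl_induct)
      case (step y z)
      then have "{y, z} \<in> S" "y \<in> V" by (auto simp: adj_rel_def)
      then show ?case using A S by (auto simp: boundary_def)
    qed (rule i)
  qed
  then show "V \<in> components n S" using i V by (auto simp: components_def)
qed

lemma components_disjoint:
  assumes "V \<in> components n S" "W \<in> components n S" "V \<noteq> W"
  shows "V \<inter> W = {}"
  using assms unfolding components_def by (auto dest: component_eqI)

text \<open>The vertices counted are the disjoint union of the components with size in
  \<open>R\<close>. The sum over candidate vertex sets makes linearity of expectation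
  applicable.\<close>

lemma card_in_eq_sum:
  assumes "S \<subseteq> Kn_edges n"
  shows "real (card_in n R S) = (\<Sum>V\<in>vsets n R. real (card V) * of_bool (V \<in> components n S))"
proof -
  let ?C = "{V \<in> vsets n R. V \<in> components n S}"
  have "{i \<in> {1..n}. card (component S i) \<in> R} = \<Union>?C"
  proof (intro equalityI subsetI)
    fix i assume i: "i \<in> {i \<in> {1..n}. card (component S i) \<in> R}"
    then have "component S i \<in> ?C"
      using component_subset[OF assms, of i] self_in_component[of i S]
      by (auto simp: vsets_def components_def)
    then show "i \<in> \<Union>?C" using self_in_component[of i S] by blast
  next
    fix i assume "i \<in> \<Union>?C"
    then obtain V j where V: "i \<in> V" "V \<in> vsets n R" "V = component S j"
      by (auto simp: components_def)
    then have "component S i = V" using component_eqI by blast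
    then show "i \<in> {i \<in> {1..n}. card (component S i) \<in> R}" using V by (auto simp: vsets_def)
  qed
  then have "card_in n R S = card (\<Union>?C)" by (simp add: card_in_def)
  also have "\<dots> = sum card ?C"
  proof (rule card_Union_disjoint)
    show "pairwise disjnt ?C"
      unfolding pairwise_def disjnt_def using components_disjoint[of _ n S] by simp
  qed (auto intro: vsets_finite)
  finally have "real (card_in n R S) = (\<Sum>V\<in>?C. real (card V))" by simp
  also have "\<dots> = (\<Sum>V\<in>vsets n R. real (card V) * of_bool (V \<in> components n S))"
    by (intro sum.mono_neutral_cong_left) (auto simp: finite_vsets)
  finally show ?thesis .
qed

lemma card_in_le: "card_in n R S \<le> n"
proof -
  have "card_in n R S \<le> card {1..n}" unfolding card_in_def by (intro card_mono) auto
  then show ?thesis by simp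
qed

section \<open>Edges leaving a vertex set\<close>

lemma boundary_eq:
  assumes "V \<subseteq> {1..n}"
  shows "boundary n V = (\<lambda>(a, b). {a, b}) ` (V \<times> ({1..n} - V))"
proof (intro equalityI subsetI)
  fix e assume e: "e \<in> boundary n V"
  then obtain a b where ab: "e = {a, b}" "a \<in> {1..n}" "b \<in> {1..n}" by (metis boundary_edgeE)
  then consider "a \<in> V" "b \<notin> V" | "b \<in> V" "a \<notin> V" using e by (auto simp: boundary_def)
  then show "e \<in> (\<lambda>(a, b). {a, b}) ` (V \<times> ({1..n} - V))"
  proof cases
    case 1
    then show ?thesis using ab by (intro image_eqI[of _ _ "(a, b)"]) auto
  next
    case 2
    then show ?thesis using ab by (intro image_eqI[of _ _ "(b, a)"]) auto
  qed
next
  fix e assume "e \<in> (\<lambda>(a, b). {a, b}) ` (V \<times> ({1..n} - V))"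
  then obtain a b where "e = {a, b}" "a \<in> V" "b \<in> {1..n}" "b \<notin> V" by auto
  then show "e \<in> boundary n V"
    using assms by (auto simp: boundary_def Kn_edges_def edges_on_iff)
qed

lemma card_boundary:
  assumes "V \<subseteq> {1..n}"
  shows "card (boundary n V) = card V * (n - card V)"
proof -
  have "inj_on (\<lambda>(a, b). {a, b}) (V \<times> ({1..n} - V))"
    by (auto simp: inj_on_def doubleton_eq_iff)
  then have "card (boundary n V) = card (V \<times> ({1..n} - V))"
    using assms by (simp add: boundary_eq card_image)
  moreover have "card ({1..n} - V) = n - card V"
    using assms by (subst card_Diff_subset) (auto intro: finite_subset)
  ultimately show ?thesis by (simp add: card_cartesian_product)
qed

text \<open>An edge that meets two disjoint sets has one end in each, since it has only two
  ends.\<close>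

lemma card_boundary_Int:
  assumes "finite V" "finite W" "V \<inter> W = {}"
  shows "card (boundary n V \<inter> boundary n W) \<le> card V * card W"
proof -
  have "boundary n V \<inter> boundary n W \<subseteq> (\<lambda>(a, b). {a, b}) ` (V \<times> W)"
  proof
    fix e assume e: "e \<in> boundary n V \<inter> boundary n W"
    then obtain a b where ab: "e = {a, b}" by (metis IntD1 boundary_edgeE)
    then consider "a \<in> V" "b \<in> W" | "b \<in> V" "a \<in> W" using e assms(3) by (auto simp: boundary_def)
    then show "e \<in> (\<lambda>(a, b). {a, b}) ` (V \<times> W)"
    proof cases
      case 1
      then show ?thesis using ab by (intro image_eqI[of _ _ "(a, b)"]) auto
    next
      case 2
      then show ?thesis using ab by (intro image_eqI[of _ _ "(b, a)"]) auto
    qed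
  qed
  then have "card (boundary n V \<inter> boundary n W) \<le> card (V \<times> W)"
    using assms by (intro surj_card_le) auto
  then show ?thesis by (simp add: card_cartesian_product)
qed

section \<open>The probability that given vertex sets are components\<close>

lemma edges_on_mono: "V \<subseteq> W \<Longrightarrow> edges_on V \<subseteq> edges_on W"
  by (auto simp: edges_on_def)

lemma edges_on_boundary_disjoint:
  assumes "V = W \<or> V \<inter> W = {}"
  shows "edges_on V \<inter> boundary n W = {}"
  using assms by (auto simp: boundary_def elim!: edges_onE)

lemma edges_on_disjoint: "V \<inter> W = {} \<Longrightarrow> edges_on V \<inter> edges_on W = {}"
  by (fastforce simp: edges_on_def card_2_iff)

lemma finite_boundary: "finite (boundary n V)"
  by (rule finite_subset[OF _ finite_Kn_edges[of n]]) (auto simp: boundary_def)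

text \<open>The probability that \<open>V\<close> is a component, in factorised form;
  \<open>expct_component\<close> justifies the name.\<close>

definition comp_prob :: "nat \<Rightarrow> (nat set \<Rightarrow> real) \<Rightarrow> nat set \<Rightarrow> real" where
  "comp_prob n p V = expct (edges_on V) p (\<lambda>X. of_bool (connected_graph V X)) *
     (\<Prod>e\<in>boundary n V. 1 - p e)"

lemma expct_component:
  assumes "V \<subseteq> {1..n}" "V \<noteq> {}"
  shows "expct (Kn_edges n) p (\<lambda>S. of_bool (V \<in> components n S)) = comp_prob n p V"
proof -
  let ?A = "edges_on V" and ?B = "boundary n V"
  \<comment> \<open>The event is written through intersections with \<open>?A\<close> and
    \<open>?B\<close>, the form required by both \<open>expct_restrict\<close> and
    \<open>expct_split\<close>.\<close>
  let ?g = "\<lambda>X. of_bool (connected_graph V (X \<inter> ?A)) * of_bool (X \<inter> ?B = {}) :: real"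
  have AB: "?A \<union> ?B \<subseteq> Kn_edges n"
    using edges_on_mono[OF assms(1)] by (auto simp: Kn_edges_def boundary_def)
  have fA: "finite ?A" using assms by (auto intro: finite_edges_on finite_subset)
  have [simp]: "S \<inter> (?A \<union> ?B) \<inter> ?A = S \<inter> ?A" "S \<inter> (?A \<union> ?B) \<inter> ?B = S \<inter> ?B" for S by auto
  have "expct (Kn_edges n) p (\<lambda>S. of_bool (V \<in> components n S)) =
    expct (Kn_edges n) p (\<lambda>S. ?g (S \<inter> (?A \<union> ?B)))"
    using assms by (intro expct_cong) (simp add: components_iff)
  also have "\<dots> = expct (?A \<union> ?B) p ?g"
    by (rule expct_restrict[OF finite_Kn_edges AB])
  also have "\<dots> = expct ?A p (\<lambda>X. of_bool (connected_graph V X)) * expct ?B p (\<lambda>X. of_bool (X = {}))"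
    by (rule expct_split[OF fA finite_boundary]) (simp add: edges_on_boundary_disjoint)
  also have "\<dots> = comp_prob n p V"
    by (simp add: comp_prob_def expct_of_bool_eq finite_boundary weight_def)
  finally show ?thesis .
qed

text \<open>Two disjoint vertex sets being components are independent events, up to the edges
  between the two sets, whose closedness the product of the probabilities counts twice.\<close>
lemma expct_two_components:
  assumes V: "V \<subseteq> {1..n}" "V \<noteq> {}" and W: "W \<subseteq> {1..n}" "W \<noteq> {}" and VW: "V \<inter> W = {}"
  shows "expct (Kn_edges n) p (\<lambda>S. of_bool (V \<in> components n S) * of_bool (W \<in> components n S)) *
      (\<Prod>e\<in>boundary n V \<inter> boundary n W. 1 - p e) = comp_prob n p V * comp_prob n p W"
proof -
  let ?A = "edges_on V" and ?B = "edges_on W" and ?D = "boundary n V \<union> boundary n W"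
  let ?a = "\<lambda>X. of_bool (connected_graph V X) :: real" and ?b = "\<lambda>X. of_bool (connected_graph W X) :: real"
  let ?ab = "\<lambda>X. ?a (X \<inter> ?A) * ?b (X \<inter> ?B)"
  let ?g = "\<lambda>X. ?ab (X \<inter> (?A \<union> ?B)) * of_bool (X \<inter> ?D = {}) :: real"
  have sub: "?A \<union> ?B \<union> ?D \<subseteq> Kn_edges n"
    using edges_on_mono[OF V(1)] edges_on_mono[OF W(1)] by (auto simp: Kn_edges_def boundary_def)
  have fin: "finite ?A" "finite ?B" using V W by (auto intro: finite_edges_on finite_subset)
  have disj: "(?A \<union> ?B) \<inter> ?D = {}" "?A \<inter> ?B = {}"
    using edges_on_boundary_disjoint VW edges_on_disjoint by (auto simp: Int_Un_distrib Int_Un_distrib2 Int_commute)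
  have [simp]: "S \<inter> (?A \<union> ?B) \<inter> ?A = S \<inter> ?A" "S \<inter> (?A \<union> ?B) \<inter> ?B = S \<inter> ?B"
    "S \<inter> (?A \<union> ?B \<union> ?D) \<inter> (?A \<union> ?B) = S \<inter> (?A \<union> ?B)" "S \<inter> (?A \<union> ?B \<union> ?D) \<inter> ?D = S \<inter> ?D" for S by auto
  have avoid: "S \<inter> ?D = {} \<longleftrightarrow> S \<inter> boundary n V = {} \<and> S \<inter> boundary n W = {}" for S by auto
  have "expct (Kn_edges n) p (\<lambda>S. of_bool (V \<in> components n S) * of_bool (W \<in> components n S)) =
    expct (Kn_edges n) p (\<lambda>S. ?g (S \<inter> (?A \<union> ?B \<union> ?D)))"
    using V W by (intro expct_cong) (simp add: components_iff avoid mult_ac)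
  also have "\<dots> = expct (?A \<union> ?B \<union> ?D) p ?g"
    by (rule expct_restrict[OF finite_Kn_edges sub])
  also have "\<dots> = expct (?A \<union> ?B) p ?ab * expct ?D p (\<lambda>X. of_bool (X = {}))"
    using fin disj by (intro expct_split) (auto simp: finite_boundary)
  also have "expct (?A \<union> ?B) p ?ab = expct ?A p ?a * expct ?B p ?b"
    using fin disj by (intro expct_split)
  also have "expct ?D p (\<lambda>X. of_bool (X = {})) = (\<Prod>e\<in>?D. 1 - p e)"
    by (simp add: expct_of_bool_eq finite_boundary weight_def)
  \<comment> \<open>Inclusion-exclusion for products: the product over the union times that over the
    intersection equals the product of the two separate ones. Keeping the intersection as a factor
    avoids dividing by a product that may vanish.\<close>
  finally show ?thesis
    using prod.union_inter[OF finite_boundary finite_boundary, of "\<lambda>e. 1 - p e" n V n W]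
    by (simp add: comp_prob_def mult_ac)
qed

section \<open>Moments of the number of vertices in small components\<close>

text \<open>Estimates at one fixed \<open>n\<close>, free of limits. Later \<open>lo\<close> and
  \<open>hi\<close> become \<open>(C - \<alpha> n) / n\<close> and
  \<open>(C + \<alpha> n) / n\<close>, which satisfy these conditions for large
  \<open>n\<close>.\<close>

locale near_uniform_graph =
  fixes n :: nat and p :: "nat set \<Rightarrow> real" and lo hi :: real
  assumes p_ge: "e \<in> Kn_edges n \<Longrightarrow> lo \<le> p e"
    and p_le: "e \<in> Kn_edges n \<Longrightarrow> p e \<le> hi"
    and lo_nonneg: "0 \<le> lo" and lo_le_hi: "lo \<le> hi" and hi_le: "hi \<le> 1"
begin

abbreviation "mean \<equiv> expct (Kn_edges n) p"

lemma p_range: "e \<in> Kn_edges n \<Longrightarrow> 0 \<le> p e \<and> p e \<le> 1"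
  using p_ge p_le lo_nonneg hi_le by force

lemma hi_nonneg: "0 \<le> hi"
  using lo_nonneg lo_le_hi by simp

lemma prod_closed_le:
  assumes "F \<subseteq> Kn_edges n"
  shows "(\<Prod>e\<in>F. 1 - p e) \<le> exp (- lo * real (card F))"
proof -
  have "(\<Prod>e\<in>F. 1 - p e) \<le> (\<Prod>e\<in>F. exp (- lo))"
  proof (rule prod_mono)
    fix e assume "e \<in> F"
    then have e: "e \<in> Kn_edges n" using assms by auto
    show "0 \<le> 1 - p e \<and> 1 - p e \<le> exp (- lo)"
      using p_range[OF e] p_ge[OF e] exp_ge_add_one_self[of "- lo"] by linarith
  qed
  also have "\<dots> = exp (- lo * real (card F))" by (simp only: prod_constant exp_of_nat2_mult)
  finally show ?thesis .
qed

lemma prod_closed_ge: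
  assumes "F \<subseteq> Kn_edges n"
  shows "(1 - hi) ^ card F \<le> (\<Prod>e\<in>F. 1 - p e)"
proof -
  have "(\<Prod>e\<in>F. 1 - hi) \<le> (\<Prod>e\<in>F. 1 - p e)"
    using assms p_le hi_le by (intro prod_mono) (auto simp: subset_iff)
  then show ?thesis by simp
qed

section \<open>Two-sided bounds on the probability of a given component\<close>

lemma comp_prob_nonneg:
  assumes "V \<subseteq> {1..n}"
  shows "0 \<le> comp_prob n p V"
proof -
  have E: "edges_on V \<subseteq> Kn_edges n" using edges_on_mono[OF assms] by (simp add: Kn_edges_def)
  have "expct (edges_on V) p (\<lambda>S. 0) \<le> expct (edges_on V) p (\<lambda>X. of_bool (connected_graph V X))"
    using E p_range by (intro expct_mono) auto
  then have "0 \<le> expct (edges_on V) p (\<lambda>X. of_bool (connected_graph V X))" by (simp add: expct_def)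
  moreover have "0 \<le> (\<Prod>e\<in>boundary n V. 1 - p e)"
    using p_range by (intro prod_nonneg) (auto simp: boundary_def)
  ultimately show ?thesis by (simp add: comp_prob_def)
qed

text \<open>A union bound over spanning trees, each open with probability at most
  \<open>hi ^ (r - 1)\<close>, times the probability that the \<open>r * (n - r)\<close> edges of
  the cut are closed.\<close>

lemma comp_prob_le:
  assumes V: "V \<subseteq> {1..n}" "V \<noteq> {}" "card V = r"
  shows "comp_prob n p V \<le> real (T r) * hi ^ (r - 1) * exp (- lo * real (r * (n - r)))"
proof -
  let ?E = "edges_on V"
  have finV: "finite V" using V finite_subset by auto
  have E: "?E \<subseteq> Kn_edges n" using edges_on_mono[OF V(1)] by (simp add: Kn_edges_def)
  have pE: "\<And>e. e \<in> ?E \<Longrightarrow> 0 \<le> p e \<and> p e \<le> 1" using E p_range by auto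
  have "expct ?E p (\<lambda>X. of_bool (connected_graph V X)) \<le>
    expct ?E p (\<lambda>X. \<Sum>t\<in>{t. is_tree V t}. of_bool (t \<subseteq> X))"
  proof (rule expct_mono[OF pE])
    fix X assume X: "X \<subseteq> ?E"
    show "of_bool (connected_graph V X) \<le> (\<Sum>t\<in>{t. is_tree V t}. of_bool (t \<subseteq> X) :: real)"
    proof (cases "connected_graph V X")
      case True
      obtain t where t: "is_tree V t" "t \<subseteq> X"
        by (rule connected_graph_contains_tree[OF True X finV V(2)])
      have "of_bool (t \<subseteq> X) \<le> (\<Sum>t\<in>{t. is_tree V t}. of_bool (t \<subseteq> X) :: real)"
        using t by (intro member_le_sum) (auto simp: finite_trees[OF finV])
      then show ?thesis using t True by simp
    qed (simp add: sum_nonneg)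
  qed
  also have "\<dots> = (\<Sum>t\<in>{t. is_tree V t}. prod p t)"
    unfolding expct_sum
    by (intro sum.cong expct_superset) (auto simp: is_tree_def finite_edges_on[OF finV])
  also have "\<dots> \<le> (\<Sum>t\<in>{t. is_tree V t}. hi ^ (r - 1))"
  proof (rule sum_mono)
    fix t assume "t \<in> {t. is_tree V t}"
    then have t: "t \<subseteq> Kn_edges n" "card t = r - 1"
      using is_tree_iff_card[OF finV V(2)] V E by auto
    have "prod p t \<le> (\<Prod>e\<in>t. hi)" using t p_range p_le by (intro prod_mono) auto
    then show "prod p t \<le> hi ^ (r - 1)" using t by simp
  qed
  also have "\<dots> = real (T r) * hi ^ (r - 1)"
    using card_trees[OF finV V(2)] V by simp
  finally have 1: "expct ?E p (\<lambda>X. of_bool (connected_graph V X)) \<le> real (T r) * hi ^ (r - 1)" .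
  have 2: "(\<Prod>e\<in>boundary n V. 1 - p e) \<le> exp (- lo * real (r * (n - r)))"
    using prod_closed_le[of "boundary n V"] card_boundary[OF V(1)] V by (auto simp: boundary_def)
  have 3: "0 \<le> (\<Prod>e\<in>boundary n V. 1 - p e)"
    using p_range by (intro prod_nonneg) (auto simp: boundary_def)
  show ?thesis unfolding comp_prob_def using hi_nonneg
    by (intro mult_mono 1 2 3) auto
qed

text \<open>Only configurations whose inner edges form exactly a tree are counted; these are
  disjoint events. The crude exponent \<open>2 ^ r\<close> for the closed inner edges is harmless,
  since \<open>r\<close> stays fixed while \<open>hi\<close> tends to 0.\<close>

lemma comp_prob_ge:
  assumes V: "V \<subseteq> {1..n}" "V \<noteq> {}" "card V = r"
  shows "real (T r) * lo ^ (r - 1) * (1 - hi) ^ (2 ^ r) * (1 - hi) ^ (r * (n - r)) \<le> comp_prob n p V"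
proof -
  let ?E = "edges_on V"
  have finV: "finite V" using V finite_subset by auto
  have E: "?E \<subseteq> Kn_edges n" using edges_on_mono[OF V(1)] by (simp add: Kn_edges_def)
  have finE: "finite ?E" by (rule finite_edges_on[OF finV])
  have pE: "\<And>e. e \<in> ?E \<Longrightarrow> 0 \<le> p e \<and> p e \<le> 1" using E p_range by auto
  have "card ?E \<le> card (Pow V)" using finV by (intro card_mono) (auto simp: edges_on_def)
  then have cE: "card ?E \<le> 2 ^ r" using finV V by (simp add: card_Pow)
  have "real (T r) * (lo ^ (r - 1) * (1 - hi) ^ (2 ^ r)) =
    (\<Sum>t\<in>{t. is_tree V t}. lo ^ (r - 1) * (1 - hi) ^ (2 ^ r))"
    using card_trees[OF finV V(2)] V by simp
  also have "\<dots> \<le> (\<Sum>t\<in>{t. is_tree V t}. weight ?E p t)"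
  proof (rule sum_mono)
    fix t assume "t \<in> {t. is_tree V t}"
    then have t: "t \<subseteq> ?E" "card t = r - 1"
      using is_tree_iff_card[OF finV V(2)] V by auto
    have "(\<Prod>e\<in>t. lo) \<le> prod p t" using t E p_ge lo_nonneg by (intro prod_mono) auto
    then have 1: "lo ^ (r - 1) \<le> prod p t" using t by simp
    have "card (?E - t) \<le> card ?E" using finE by (intro card_mono) auto
    then have "(1 - hi) ^ (2 ^ r) \<le> (1 - hi) ^ card (?E - t)"
      using hi_nonneg hi_le cE by (intro power_decreasing) auto
    also have "\<dots> \<le> (\<Prod>e\<in>?E - t. 1 - p e)" using E by (intro prod_closed_ge) auto
    finally show "lo ^ (r - 1) * (1 - hi) ^ (2 ^ r) \<le> weight ?E p t"
      unfolding weight_def using 1 hi_le lo_nonneg t pE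
      by (intro mult_mono prod_nonneg) auto
  qed
  also have "\<dots> = expct ?E p (\<lambda>X. \<Sum>t\<in>{t. is_tree V t}. of_bool (X = t))"
    unfolding expct_sum
    by (intro sum.cong expct_of_bool_eq[symmetric]) (auto simp: is_tree_def finE)
  also have "\<dots> \<le> expct ?E p (\<lambda>X. of_bool (connected_graph V X))"
  proof (rule expct_mono[OF pE])
    fix X assume X: "X \<subseteq> ?E"
    have "(\<Sum>t\<in>{t. is_tree V t}. of_bool (X = t) :: real) = (\<Sum>t\<in>{t. is_tree V t}. if X = t then 1 else 0)"
      by (intro sum.cong) auto
    also have "\<dots> = of_bool (is_tree V X)"
      by (subst sum.delta') (auto simp: finite_trees[OF finV])
    also have "\<dots> \<le> of_bool (connected_graph V X)" by (simp add: is_tree_def)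
    finally show "(\<Sum>t\<in>{t. is_tree V t}. of_bool (X = t) :: real) \<le> of_bool (connected_graph V X)" .
  qed
  finally have 1: "real (T r) * (lo ^ (r - 1) * (1 - hi) ^ (2 ^ r)) \<le>
    expct ?E p (\<lambda>X. of_bool (connected_graph V X))" .
  have 2: "(1 - hi) ^ (r * (n - r)) \<le> (\<Prod>e\<in>boundary n V. 1 - p e)"
    using prod_closed_ge[of "boundary n V"] card_boundary[OF V(1)] V by (auto simp: boundary_def)
  have "real (T r) * (lo ^ (r - 1) * (1 - hi) ^ (2 ^ r)) * (1 - hi) ^ (r * (n - r)) \<le> comp_prob n p V"
    unfolding comp_prob_def using hi_le lo_nonneg
    by (intro mult_mono 1 2 order_trans[OF _ 1] mult_nonneg_nonneg) auto
  then show ?thesis by (simp add: mult.assoc)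
qed

section \<open>First and second moments by component size\<close>

lemma expct_card_in: "mean (\<lambda>S. real (card_in n R S)) = (\<Sum>V\<in>vsets n R. real (card V) * comp_prob n p V)"
proof -
  have "mean (\<lambda>S. real (card_in n R S)) =
    mean (\<lambda>S. \<Sum>V\<in>vsets n R. real (card V) * of_bool (V \<in> components n S))"
    by (intro expct_cong card_in_eq_sum)
  also have "\<dots> = (\<Sum>V\<in>vsets n R. real (card V) * comp_prob n p V)"
    unfolding expct_sum expct_cmult
    by (intro sum.cong) (auto simp: vsets_def expct_component)
  finally show ?thesis .
qed

lemma expct_card_in_split:
  assumes "finite R"
  shows "mean (\<lambda>S. real (card_in n R S)) = (\<Sum>r\<in>R. mean (\<lambda>S. real (card_in n {r} S)))"
proof -
  have "(\<Sum>r\<in>R. mean (\<lambda>S. real (card_in n {r} S))) =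
    (\<Sum>r\<in>R. \<Sum>V\<in>{V \<in> vsets n R. card V = r}. real (card V) * comp_prob n p V)"
    unfolding expct_card_in by (intro sum.cong) (auto simp: vsets_def)
  also have "\<dots> = (\<Sum>V\<in>vsets n R. real (card V) * comp_prob n p V)"
    using assms by (intro sum.group finite_vsets) (auto simp: vsets_def)
  finally show ?thesis by (simp add: expct_card_in)
qed

lemma card_vsets_single:
  assumes "0 < r"
  shows "card (vsets n {r}) = n choose r"
proof -
  have "vsets n {r} = {V. V \<subseteq> {1..n} \<and> card V = r}" using assms by (auto simp: vsets_def)
  then show ?thesis using n_subsets[of "{1..n}" r] by simp
qed

lemma expct_card_in_single_le:
  assumes "0 < r"
  shows "mean (\<lambda>S. real (card_in n {r} S)) \<le>
    real r * real (n choose r) * (real (T r) * hi ^ (r - 1) * exp (- lo * real (r * (n - r))))"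
proof -
  have "mean (\<lambda>S. real (card_in n {r} S)) \<le>
    (\<Sum>V\<in>vsets n {r}. real r * (real (T r) * hi ^ (r - 1) * exp (- lo * real (r * (n - r)))))"
    unfolding expct_card_in
    using comp_prob_le[of _ r] by (intro sum_mono) (simp add: vsets_def mult_left_mono)
  then show ?thesis using card_vsets_single[OF assms] by (simp add: mult_ac)
qed

lemma expct_card_in_single_ge:
  assumes "0 < r"
  shows "real r * real (n choose r) *
      (real (T r) * lo ^ (r - 1) * (1 - hi) ^ (2 ^ r) * (1 - hi) ^ (r * (n - r))) \<le>
    mean (\<lambda>S. real (card_in n {r} S))"
proof -
  have "(\<Sum>V\<in>vsets n {r}. real r *
      (real (T r) * lo ^ (r - 1) * (1 - hi) ^ (2 ^ r) * (1 - hi) ^ (r * (n - r)))) \<le>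
    mean (\<lambda>S. real (card_in n {r} S))"
    unfolding expct_card_in
    using comp_prob_ge[of _ r] by (intro sum_mono) (simp add: vsets_def mult_left_mono)
  then show ?thesis using card_vsets_single[OF assms] by (simp add: mult_ac)
qed

text \<open>For disjoint sets the correction factor is the probability that the at most
  \<open>K\<^sup>2\<close> edges between them are closed, bounded below by Bernoulli's inequality.
  Distinct overlapping sets are never both components.\<close>

lemma expct_two_components_le:
  assumes V: "V \<in> vsets n {..K}" and W: "W \<in> vsets n {..K}" and VW: "V \<noteq> W" and K: "real (K\<^sup>2) * hi < 1"
  shows "mean (\<lambda>S. of_bool (V \<in> components n S) * of_bool (W \<in> components n S)) \<le>
    comp_prob n p V * comp_prob n p W / (1 - real (K\<^sup>2) * hi)"
proof (cases "V \<inter> W = {}")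
  case True
  let ?J = "mean (\<lambda>S. of_bool (V \<in> components n S) * of_bool (W \<in> components n S))"
  let ?B = "boundary n V \<inter> boundary n W"
  have "mean (\<lambda>S. 0) \<le> ?J" using p_range by (intro expct_mono) auto
  then have J: "0 \<le> ?J" by (simp add: expct_def)
  have "card ?B \<le> card V * card W" using V W True by (intro card_boundary_Int) (auto intro: vsets_finite)
  also have "\<dots> \<le> K\<^sup>2" using V W by (auto simp: vsets_def power2_eq_square intro: mult_mono)
  finally have "(1 - hi) ^ (K\<^sup>2) \<le> (1 - hi) ^ card ?B"
    using hi_nonneg hi_le by (intro power_decreasing) auto
  also have "\<dots> \<le> (\<Prod>e\<in>?B. 1 - p e)" by (intro prod_closed_ge) (auto simp: boundary_def)
  finally have "1 - real (K\<^sup>2) * hi \<le> (\<Prod>e\<in>?B. 1 - p e)"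
    using Bernoulli_inequality[of "- hi" "K\<^sup>2"] hi_le by simp
  then have "?J * (1 - real (K\<^sup>2) * hi) \<le> ?J * (\<Prod>e\<in>?B. 1 - p e)" using J by (rule mult_left_mono)
  also have "\<dots> = comp_prob n p V * comp_prob n p W"
    using V W True by (intro expct_two_components) (auto simp: vsets_def)
  finally show ?thesis using K by (simp add: pos_le_divide_eq)
next
  case False
  have "mean (\<lambda>S. of_bool (V \<in> components n S) * of_bool (W \<in> components n S)) = mean (\<lambda>S. 0)"
    using components_disjoint[of V n _ W] VW False by (intro expct_cong) auto
  also have "\<dots> \<le> comp_prob n p V * comp_prob n p W / (1 - real (K\<^sup>2) * hi)"
    using K V W comp_prob_nonneg by (auto simp: expct_def vsets_def)
  finally show ?thesis .
qed

lemma expct_card_in_square_le: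
  assumes R: "R \<subseteq> {..K}" and K: "real (K\<^sup>2) * hi < 1"
  shows "mean (\<lambda>S. (real (card_in n R S))\<^sup>2) \<le>
    real K * real n + (mean (\<lambda>S. real (card_in n R S)))\<^sup>2 / (1 - real (K\<^sup>2) * hi)"
proof -
  let ?Vs = "vsets n R" and ?c = "\<lambda>V. real (card V)"
  let ?I = "\<lambda>V S. of_bool (V \<in> components n S) :: real"
  let ?D = "1 - real (K\<^sup>2) * hi"
  have sub: "V \<in> vsets n {..K}" if "V \<in> ?Vs" for V using that R by (auto simp: vsets_def)
  have "mean (\<lambda>S. (real (card_in n R S))\<^sup>2) = mean (\<lambda>S. \<Sum>V\<in>?Vs. \<Sum>W\<in>?Vs. ?c V * ?c W * (?I V S * ?I W S))"
    by (intro expct_cong) (simp add: card_in_eq_sum power2_eq_square sum_product mult_ac)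
  also have "\<dots> = (\<Sum>V\<in>?Vs. \<Sum>W\<in>?Vs. ?c V * ?c W * mean (\<lambda>S. ?I V S * ?I W S))"
    by (simp add: expct_sum expct_cmult)
  \<comment> \<open>Diagonal pairs contribute at most \<open>K\<close> times the mean. The
    nonnegative product term is kept on the diagonal as well, so that the double sum becomes a
    square.\<close>
  also have "\<dots> \<le> (\<Sum>V\<in>?Vs. \<Sum>W\<in>?Vs. (if W = V then real K * (?c V * comp_prob n p V) else 0) +
      (?c V * comp_prob n p V) * (?c W * comp_prob n p W) / ?D)"
  proof (intro sum_mono)
    fix V W assume V: "V \<in> ?Vs" and W: "W \<in> ?Vs"
    have pos: "0 \<le> (?c V * comp_prob n p V) * (?c W * comp_prob n p W) / ?D"
      using V W K comp_prob_nonneg by (auto simp: vsets_def)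
    show "?c V * ?c W * mean (\<lambda>S. ?I V S * ?I W S) \<le> (if W = V then real K * (?c V * comp_prob n p V) else 0) +
      (?c V * comp_prob n p V) * (?c W * comp_prob n p W) / ?D"
    proof (cases "W = V")
      case True
      have "mean (\<lambda>S. ?I V S * ?I W S) = mean (?I V)" using True by (intro expct_cong) auto
      also have "\<dots> = comp_prob n p V" using V by (intro expct_component) (auto simp: vsets_def)
      finally have "?c V * ?c W * mean (\<lambda>S. ?I V S * ?I W S) = ?c V * (?c V * comp_prob n p V)"
        using True by simp
      also have "\<dots> \<le> real K * (?c V * comp_prob n p V)"
        using sub[OF V] comp_prob_nonneg[of V] by (intro mult_right_mono) (auto simp: vsets_def)
      finally show ?thesis using True pos by simp
    next
      case False
      have "?c V * ?c W * mean (\<lambda>S. ?I V S * ?I W S) \<le>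
        ?c V * ?c W * (comp_prob n p V * comp_prob n p W / ?D)"
        using expct_two_components_le[OF sub[OF V] sub[OF W] _ K] False by (intro mult_left_mono) auto
      then show ?thesis using False by (simp add: mult_ac)
    qed
  qed
  also have "\<dots> = real K * (\<Sum>V\<in>?Vs. ?c V * comp_prob n p V) + (\<Sum>V\<in>?Vs. ?c V * comp_prob n p V)\<^sup>2 / ?D"
    by (simp add: sum.distrib sum_distrib_left[of "real K"] power2_eq_square[of "sum _ _"] sum_product
        sum_divide_distrib finite_vsets)
  also have "\<dots> = real K * mean (\<lambda>S. real (card_in n R S)) + (mean (\<lambda>S. real (card_in n R S)))\<^sup>2 / ?D"
    by (simp add: expct_card_in)
  finally have *: "mean (\<lambda>S. (real (card_in n R S))\<^sup>2) \<le>
    real K * mean (\<lambda>S. real (card_in n R S)) + (mean (\<lambda>S. real (card_in n R S)))\<^sup>2 / ?D" .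
  have "mean (\<lambda>S. real (card_in n R S)) \<le> mean (\<lambda>S. real n * 1)"
    using p_range card_in_le by (intro expct_mono) auto
  also have "\<dots> = real n"
    using expct_cmult[of "Kn_edges n" p "real n" "\<lambda>S. 1"] expct_one[OF finite_Kn_edges] by simp
  finally have "real K * mean (\<lambda>S. real (card_in n R S)) \<le> real K * real n" by (simp add: mult_left_mono)
  then show ?thesis using * by linarith
qed

end

section \<open>Asymptotics\<close>

text \<open>The term of index \<open>r\<close> in the exponential series at \<open>r\<close> is at
  most the whole sum.\<close>

lemma power_self_le_exp_fact: "real r ^ r \<le> exp (real r) * fact r"
proof -
  have s: "(\<lambda>k. real r ^ k /\<^sub>R fact k) sums exp (real r)" by (rule exp_converges)
  have "sum (\<lambda>k. real r ^ k /\<^sub>R fact k) {r} \<le> exp (real r)"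
    using sum_le_suminf[OF sums_summable[OF s], of "{r}"] sums_unique[OF s] by simp
  then show ?thesis by (simp add: field_simps)
qed

lemma binomial_fact_le: "real (n choose r) * fact r \<le> real n ^ r"
proof -
  have "(n choose r) * fact r \<le> n ^ r"
    by (rule binomial_fact_pow)
  then show ?thesis by (metis of_nat_fact of_nat_le_iff of_nat_mult of_nat_power)
qed

text \<open>Induction on \<open>r\<close> through the recurrence
  \<open>Suc r * (n choose Suc r) = (n - r) * (n choose r)\<close>.\<close>

lemma binomial_asymp: "(\<lambda>n. real (n choose r) / real n ^ r) \<longlonglongrightarrow> 1 / fact r"
proof (induction r)
  case (Suc r)
  have lim: "(\<lambda>n. real (n choose r) / real n ^ r * (1 - real r / real n) / real (Suc r))
      \<longlonglongrightarrow> 1 / fact r * (1 - 0) / real (Suc r)"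
    by (intro tendsto_intros Suc.IH lim_const_over_n) simp
  have ev: "eventually (\<lambda>n. real (n choose r) / real n ^ r * (1 - real r / real n) / real (Suc r) =
      real (n choose Suc r) / real n ^ Suc r) sequentially"
    using eventually_ge_at_top[of "Suc r"]
  proof eventually_elim
    case (elim n)
    have "Suc r * (n choose Suc r) = (n - r) * (n choose r)"
      by (metis binomial_absorb_comp binomial_absorption mult.commute)
    then have eq: "real (Suc r) * real (n choose Suc r) = (real n - real r) * real (n choose r)"
      using elim by (metis Suc_leD of_nat_diff of_nat_mult)
    have n: "0 < real n" using elim by simp
    have A: "real (n choose r) / real n ^ r * (1 - real r / real n) / real (Suc r) =
      ((real n - real r) * real (n choose r) / real (Suc r)) / real n ^ Suc r"
    proof -
      have e: "1 - real r / real n = (real n - real r) / real n" using n by (simp add: field_simps)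
      show ?thesis unfolding e by (simp add: mult_ac)
    qed
    have B: "real (n choose Suc r) = (real n - real r) * real (n choose r) / real (Suc r)"
      using eq by (simp add: field_simps)
    show ?case using A by (simp only: B)
  qed
  have eq: "1 / fact r * (1 - 0) / real (Suc r) = (1 / fact (Suc r) :: real)" by (simp add: field_simps)
  show ?case using Lim_transform_eventually[OF lim ev] unfolding eq .
qed simp

text \<open>\<open>R\<close> is an arbitrary finite set because the size windows are cut out by
  inequalities between reals.\<close>

lemma geometric_tail_le:
  fixes x :: real
  assumes x: "0 < x" "x < 1" and R: "finite R" "\<And>r. r \<in> R \<Longrightarrow> r0 \<le> r"
  shows "(\<Sum>r\<in>R. x ^ r) \<le> x ^ r0 / (1 - x)"
proof -
  have inj: "inj_on (\<lambda>r. r - r0) R" using R(2) by (auto simp: inj_on_def eq_diff_iff)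
  have "(\<Sum>r\<in>R. x ^ r) = x ^ r0 * (\<Sum>r\<in>R. x ^ (r - r0))"
    unfolding sum_distrib_left using R(2) by (intro sum.cong) (auto simp flip: power_add)
  also have "(\<Sum>r\<in>R. x ^ (r - r0)) = (\<Sum>k\<in>(\<lambda>r. r - r0) ` R. x ^ k)"
    using inj by (simp add: sum.reindex)
  also have "\<dots> \<le> (\<Sum>k. x ^ k)" using x R by (intro sum_le_suminf summable_geometric) auto
  also have "\<dots> = 1 / (1 - x)" using x by (intro suminf_geometric) auto
  finally show ?thesis using x by (simp add: mult_left_mono)
qed

text \<open>The limiting fraction of vertices in components of size \<open>r\<close>. This is the
  summand of \<open>q C\<close>, indexed by the size itself instead of from 0.\<close>

definition tree_term :: "real \<Rightarrow> nat \<Rightarrow> real" where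
  "tree_term C r = real (T r) * C ^ (r - 1) * exp (- C * real r) / fact (r - 1)"

lemma T_le_exp:
  assumes "0 < r"
  shows "real r * real (T r) \<le> exp (real r) * fact r"
proof -
  have "r * T r \<le> r * r ^ (r - 1)" using T_le[of r] by simp
  also have "\<dots> = r ^ r" using assms by (simp add: power_eq_if)
  finally have "real r * real (T r) \<le> real r ^ r" by (metis of_nat_le_iff of_nat_mult of_nat_power)
  then show ?thesis using power_self_le_exp_fact[of r] by linarith
qed

lemma power_pred_le_exp:
  assumes "1 \<le> (c::real)"
  shows "c ^ (r - 1) \<le> exp (real r * ln c)"
proof -
  have "c ^ (r - 1) \<le> c ^ r" using assms by (intro power_increasing) auto
  also have "\<dots> = exp (real r * ln c)" using assms by (simp add: exp_of_nat_mult)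
  finally show ?thesis .
qed

text \<open>After expanding with \<open>r\<close>, the factorial cancels against the one in
  \<open>T_le_exp\<close>. The factors \<open>exp r\<close>, \<open>exp (r * ln C)\<close> and
  \<open>exp (- C * r)\<close> remain and combine to the rate \<open>C - 1 - ln C\<close>.\<close>

lemma tree_term_le:
  assumes "1 < C" "0 < r"
  shows "tree_term C r \<le> exp (- (C - 1 - ln C)) ^ r"
proof -
  have r: "real r * fact (r - 1) = (fact r :: real)" using assms by (simp add: fact_reduce)
  have "tree_term C r = (real r * real (T r)) * C ^ (r - 1) * exp (- C * real r) / fact r"
    using assms unfolding tree_term_def r[symmetric] by simp
  also have "\<dots> \<le> (exp (real r) * fact r) * exp (real r * ln C) * exp (- C * real r) / fact r"
    using power_pred_le_exp[of C r] assms
    by (intro divide_right_mono mult_right_mono mult_mono[OF T_le_exp]) auto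
  also have "\<dots> = exp (real r * (- (C - 1 - ln C)))"
    by (simp add: algebra_simps flip: exp_add)
  also have "\<dots> = exp (- (C - 1 - ln C)) ^ r" by (rule exp_of_nat_mult)
  finally show ?thesis .
qed

lemma decay_rate_pos:
  assumes "1 < (C::real)"
  shows "0 < C - 1 - ln C"
  using assms ln_le_minus_one[of C] ln_eq_minus_one[of C] by fastforce

text \<open>The infinite sum in \<open>q\<close> carries no convergence statement; summability comes
  from the geometric bound \<open>tree_term_le\<close>.\<close>

lemma tree_term_sums:
  assumes "1 < C"
  shows "(\<lambda>K. \<Sum>r=1..K. tree_term C r) \<longlonglongrightarrow> q C"
proof -
  let ?x = "exp (- (C - 1 - ln C))"
  have x: "0 < ?x" "?x < 1" using decay_rate_pos[OF assms] by auto
  have "summable (\<lambda>r. ?x ^ Suc r)"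
    using x summable_Suc_iff[of "\<lambda>r. ?x ^ r"] by (simp add: summable_geometric)
  then have "summable (\<lambda>r. tree_term C (Suc r))"
  proof (rule summable_comparison_test')
    fix r :: nat
    have "0 \<le> tree_term C (Suc r)" using assms by (simp add: tree_term_def)
    then show "norm (tree_term C (Suc r)) \<le> ?x ^ Suc r"
      using tree_term_le[OF assms, of "Suc r"] by simp
  qed
  then have "(\<lambda>K. \<Sum>r<K. tree_term C (Suc r)) \<longlonglongrightarrow> (\<Sum>r. tree_term C (Suc r))"
    by (rule summable_LIMSEQ)
  moreover have "(\<Sum>r<K. tree_term C (Suc r)) = (\<Sum>r=1..K. tree_term C r)" for K
    by (simp add: sum.atLeast1_atMost_eq)
  ultimately show ?thesis by (simp add: q_def tree_term_def)
qed

section \<open>Limits of the moments as \<open>n\<close> grows\<close>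

locale sparse_graphs =
  fixes C :: real and \<alpha> :: "nat \<Rightarrow> real" and p :: "nat \<Rightarrow> nat set \<Rightarrow> real"
  assumes C_gt: "C > 1"
    and alpha_nonneg: "\<And>n. \<alpha> n \<ge> 0"
    and alpha_lim: "\<alpha> \<longlonglongrightarrow> 0"
    and p_bounds: "\<And>n e. e \<in> Kn_edges n \<Longrightarrow>
                     (C - \<alpha> n) / real n \<le> p n e \<and> p n e \<le> (C + \<alpha> n) / real n"
begin

abbreviation "lo n \<equiv> (C - \<alpha> n) / real n"
abbreviation "hi n \<equiv> (C + \<alpha> n) / real n"
abbreviation "mean_card n R \<equiv> expct (Kn_edges n) (p n) (\<lambda>S. real (card_in n R S))"

lemma hi_lim: "hi \<longlonglongrightarrow> 0"
proof -
  have "(\<lambda>n. (C + \<alpha> n) * (1 / real n)) \<longlonglongrightarrow> (C + 0) * 0"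
    by (intro tendsto_intros alpha_lim lim_const_over_n)
  then show ?thesis by simp
qed

text \<open>\<open>\<alpha> n < C\<close> makes \<open>lo n\<close> nonnegative, and
  \<open>hi n\<close> drops below 1 because it tends to 0. The conjunct \<open>0 < n\<close> is
  recorded for later divisions.\<close>

lemma eventually_near_uniform:
  "eventually (\<lambda>n. near_uniform_graph n (p n) (lo n) (hi n) \<and> 0 < n) sequentially"
proof -
  have "eventually (\<lambda>n. \<alpha> n < C) sequentially" using order_tendstoD(2)[OF alpha_lim, of C] C_gt by simp
  moreover have "eventually (\<lambda>n. hi n < 1) sequentially" by (rule order_tendstoD(2)[OF hi_lim]) simp
  ultimately show ?thesis using eventually_gt_at_top[of 0]
  proof eventually_elim
    case (elim n)
    have "lo n \<le> hi n" using alpha_nonneg[of n] by (intro divide_right_mono) auto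
    moreover have "0 \<le> lo n" using elim by simp
    ultimately show ?case using elim p_bounds by (auto intro!: near_uniform_graph.intro)
  qed
qed

lemma lo_exponent:
  assumes "r \<le> n" "0 < n"
  shows "- lo n * real (r * (n - r)) = - (C - \<alpha> n) * (real r * (1 - real r / real n))"
proof -
  have "lo n * real (r * (n - r)) = (C - \<alpha> n) * (real r * (real (n - r) / real n))" by simp
  also have "real (n - r) / real n = 1 - real r / real n"
    using assms by (simp add: of_nat_diff diff_divide_distrib)
  finally show ?thesis by (simp only: mult_minus_left)
qed

text \<open>The bounds for fixed \<open>n\<close>, divided by \<open>n\<close>, are sandwiched
  between \<open>?L\<close> and \<open>?U\<close>. The powers of \<open>n\<close> in the binomial
  coefficient and in the edge probabilities cancel, and both sides tend to
  \<open>tree_term C r\<close>.\<close>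

lemma mean_single_lim:
  assumes r: "0 < r"
  shows "(\<lambda>n. mean_card n {r} / real n) \<longlonglongrightarrow> tree_term C r"
proof -
  let ?b = "\<lambda>n. real (n choose r) / real n ^ r"
  let ?U = "\<lambda>n. real r * ?b n * real (T r) * (C + \<alpha> n) ^ (r - 1) *
    exp (- (C - \<alpha> n) * (real r * (1 - real r / real n)))"
  let ?L = "\<lambda>n. real r * ?b n * real (T r) * (C - \<alpha> n) ^ (r - 1) * (1 - hi n) ^ (2 ^ r) *
    exp (- (C + \<alpha> n) - 2 * (C + \<alpha> n) * hi n) ^ r"
  have term_eq: "real r * (1 / fact r) * real (T r) * C ^ (r - 1) * exp (- C * real r) = tree_term C r"
    using r by (simp add: tree_term_def fact_reduce field_simps)
  have "?U \<longlonglongrightarrow> real r * (1 / fact r) * real (T r) * (C + 0) ^ (r - 1) *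
      exp (- (C - 0) * (real r * (1 - 0)))"
    by (intro tendsto_intros binomial_asymp alpha_lim lim_const_over_n)
  then have U: "?U \<longlonglongrightarrow> tree_term C r" using term_eq by simp
  have "?L \<longlonglongrightarrow> real r * (1 / fact r) * real (T r) * (C - 0) ^ (r - 1) * (1 - 0) ^ (2 ^ r) *
      exp (- (C + 0) - 2 * (C + 0) * 0) ^ r"
    by (intro tendsto_intros binomial_asymp alpha_lim hi_lim)
  moreover have "exp (- C) ^ r = exp (- C * real r)" by (simp only: exp_of_nat2_mult)
  ultimately have L: "?L \<longlonglongrightarrow> tree_term C r" using term_eq by simp
  have half: "eventually (\<lambda>n. hi n < 1/2) sequentially" by (rule order_tendstoD(2)[OF hi_lim]) simp
  show ?thesis
  proof (rule tendsto_sandwich[OF _ _ L U])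
    show "eventually (\<lambda>n. mean_card n {r} / real n \<le> ?U n) sequentially"
      using eventually_near_uniform eventually_ge_at_top[of r]
    proof eventually_elim
      case (elim n)
      then interpret near_uniform_graph n "p n" "lo n" "hi n" by simp
      have n: "0 < n" using elim by simp
      have "real n ^ r = real n * real n ^ (r - 1)" using r by (simp add: power_eq_if)
      then have "real r * real (n choose r) *
          (real (T r) * hi n ^ (r - 1) * exp (- lo n * real (r * (n - r)))) = ?U n * real n"
        unfolding lo_exponent[OF elim(2) n] using n by (simp add: power_divide)
      then show ?case using expct_card_in_single_le[OF r] n by (simp add: pos_divide_le_eq)
    qed
    show "eventually (\<lambda>n. ?L n \<le> mean_card n {r} / real n) sequentially"
      using eventually_near_uniform eventually_ge_at_top[of r] half
    proof eventually_elim
      case (elim n)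
      then interpret near_uniform_graph n "p n" "lo n" "hi n" by simp
      have n: "0 < n" using elim by simp
      have h: "0 < 1 - hi n" "hi n \<le> 1/2" using elim by linarith+
      \<comment> \<open>Uses \<open>ln (1 - h) \<ge> - h - 2 * h\<^sup>2\<close> for
        \<open>0 \<le> h \<le> 1/2\<close>. Raised to the power \<open>n * r\<close>, the quadratic
        term contributes an exponent that vanishes in the limit.\<close>
      have "exp (- hi n - 2 * (hi n)\<^sup>2) \<le> exp (ln (1 - hi n))"
        using ln_one_minus_pos_lower_bound[OF hi_nonneg h(2)] by (simp only: exp_le_cancel_iff)
      then have "exp (- hi n - 2 * (hi n)\<^sup>2) \<le> 1 - hi n" unfolding exp_ln[OF h(1)] .
      then have "exp (- hi n - 2 * (hi n)\<^sup>2) ^ (n * r) \<le> (1 - hi n) ^ (n * r)"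
        by (intro power_mono) auto
      also have "\<dots> \<le> (1 - hi n) ^ (r * (n - r))"
        using hi_nonneg hi_le by (intro power_decreasing) auto
      finally have *: "exp (- hi n - 2 * (hi n)\<^sup>2) ^ (n * r) \<le> (1 - hi n) ^ (r * (n - r))" .
      have "real n * (- hi n - 2 * (hi n)\<^sup>2) = - (C + \<alpha> n) - 2 * (C + \<alpha> n) * hi n"
      proof -
        have "real n * (- h - 2 * h\<^sup>2) = - (real n * h) - 2 * (real n * h) * h" for h
          by (simp add: power2_eq_square algebra_simps)
        moreover have "real n * hi n = C + \<alpha> n" using n by simp
        ultimately show ?thesis by metis
      qed
      then have "exp (- (C + \<alpha> n) - 2 * (C + \<alpha> n) * hi n) ^ r = exp (- hi n - 2 * (hi n)\<^sup>2) ^ (n * r)"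
        by (metis exp_of_nat_mult power_mult)
      then have e: "exp (- (C + \<alpha> n) - 2 * (C + \<alpha> n) * hi n) ^ r \<le> (1 - hi n) ^ (r * (n - r))"
        using * by simp
      have pw: "real n ^ r = real n * real n ^ (r - 1)" using r by (simp add: power_eq_if)
      have "?L n * real n = real r * real (n choose r) *
        (real (T r) * lo n ^ (r - 1) * (1 - hi n) ^ (2 ^ r) * exp (- (C + \<alpha> n) - 2 * (C + \<alpha> n) * hi n) ^ r)"
        unfolding pw using n by (simp add: power_divide)
      also have "\<dots> \<le> real r * real (n choose r) *
        (real (T r) * lo n ^ (r - 1) * (1 - hi n) ^ (2 ^ r) * (1 - hi n) ^ (r * (n - r)))"
        using e lo_nonneg hi_le by (intro mult_left_mono mult_nonneg_nonneg) auto
      also have "\<dots> \<le> mean_card n {r}" by (rule expct_card_in_single_ge[OF r])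
      finally show ?case using n by (simp add: pos_le_divide_eq)
    qed
  qed
qed

lemma mean_lim: "(\<lambda>n. mean_card n {1..K} / real n) \<longlonglongrightarrow> (\<Sum>r=1..K. tree_term C r)"
proof -
  have "(\<lambda>n. \<Sum>r=1..K. mean_card n {r} / real n) \<longlonglongrightarrow> (\<Sum>r=1..K. tree_term C r)"
    by (intro tendsto_sum mean_single_lim) auto
  moreover have "eventually (\<lambda>n. (\<Sum>r=1..K. mean_card n {r} / real n) = mean_card n {1..K} / real n) sequentially"
    using eventually_near_uniform
  proof eventually_elim
    case (elim n)
    then interpret near_uniform_graph n "p n" "lo n" "hi n" by simp
    show ?case using expct_card_in_split[of "{1..K}"] by (simp add: sum_divide_distrib)
  qed
  ultimately show ?thesis by (rule Lim_transform_eventually)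
qed

text \<open>The square is centred at the limit \<open>Q K\<close> instead of the mean, so that
  Chebyshev's inequality gives closeness to \<open>Q K\<close> directly. The second moment bound
  tends to \<open>Q\<^sup>2\<close>, and \<open>Q\<^sup>2 - 2 * Q\<^sup>2 + Q\<^sup>2 = 0\<close>
  with \<open>Q\<close> for \<open>Q K\<close>.\<close>

lemma mean_square_lim:
  defines "Q \<equiv> \<lambda>K. \<Sum>r=1..K. tree_term C r"
  shows "(\<lambda>n. expct (Kn_edges n) (p n) (\<lambda>S. (real (card_in n {1..K} S) / real n - Q K)\<^sup>2)) \<longlonglongrightarrow> 0"
proof (rule tendsto_sandwich[of "\<lambda>_. 0"])
  let ?m = "\<lambda>n. mean_card n {1..K} / real n"
  let ?U = "\<lambda>n. real K / real n + (?m n)\<^sup>2 / (1 - real (K\<^sup>2) * hi n) - 2 * Q K * ?m n + (Q K)\<^sup>2"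
  have "?U \<longlonglongrightarrow> 0 + (Q K)\<^sup>2 / (1 - real (K\<^sup>2) * 0) - 2 * Q K * Q K + (Q K)\<^sup>2"
    unfolding Q_def by (intro tendsto_intros mean_lim hi_lim lim_const_over_n) auto
  then show "?U \<longlonglongrightarrow> 0" by (simp add: power2_eq_square)
  have "(\<lambda>n. real (K\<^sup>2) * hi n) \<longlonglongrightarrow> real (K\<^sup>2) * 0" by (intro tendsto_intros hi_lim)
  then have "eventually (\<lambda>n. real (K\<^sup>2) * hi n < 1) sequentially" by (rule order_tendstoD(2)) simp
  then show "eventually (\<lambda>n. expct (Kn_edges n) (p n)
      (\<lambda>S. (real (card_in n {1..K} S) / real n - Q K)\<^sup>2) \<le> ?U n) sequentially"
    using eventually_near_uniform
  proof eventually_elim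
    case (elim n)
    then interpret near_uniform_graph n "p n" "lo n" "hi n" by simp
    let ?E = "expct (Kn_edges n) (p n)" and ?N = "\<lambda>S. real (card_in n {1..K} S)"
    have n: "0 < n" using elim by simp
    have "?E (\<lambda>S. (?N S / real n - Q K)\<^sup>2) =
      ?E (\<lambda>S. 1 / (real n)\<^sup>2 * (?N S)\<^sup>2 - 2 * Q K / real n * ?N S + (Q K)\<^sup>2 * 1)"
      by (simp add: power2_diff power_divide algebra_simps)
    also have "\<dots> = 1 / (real n)\<^sup>2 * ?E (\<lambda>S. (?N S)\<^sup>2) - 2 * Q K / real n * ?E ?N + (Q K)\<^sup>2"
      unfolding expct_add expct_diff expct_cmult by (simp add: expct_one finite_Kn_edges)
    also have "\<dots> \<le> 1 / (real n)\<^sup>2 * (real K * real n + (mean_card n {1..K})\<^sup>2 / (1 - real (K\<^sup>2) * hi n)) -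
        2 * Q K / real n * mean_card n {1..K} + (Q K)\<^sup>2"
      using expct_card_in_square_le[of "{1..K}" K] elim
      by (intro add_right_mono diff_right_mono mult_left_mono) auto
    also have "\<dots> = ?U n"
    proof -
      have "1 / (real n)\<^sup>2 * (real K * real n + m\<^sup>2 / D) - 2 * Q K / real n * m + (Q K)\<^sup>2 =
        real K / real n + (m / real n)\<^sup>2 / D - 2 * Q K * (m / real n) + (Q K)\<^sup>2" for m D
        using n by (simp add: distrib_left power2_eq_square)
      then show ?thesis .
    qed
    finally show ?case .
  qed
  show "eventually (\<lambda>n. 0 \<le> expct (Kn_edges n) (p n)
      (\<lambda>S. (real (card_in n {1..K} S) / real n - Q K)\<^sup>2)) sequentially"
    using eventually_near_uniform
  proof eventually_elim
    case (elim n)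
    then interpret near_uniform_graph n "p n" "lo n" "hi n" by simp
    have "expct (Kn_edges n) (p n) (\<lambda>S. 0) \<le>
      expct (Kn_edges n) (p n) (\<lambda>S. (real (card_in n {1..K} S) / real n - Q K)\<^sup>2)"
      using p_range by (intro expct_mono) auto
    then show ?case by (simp add: expct_def)
  qed
qed simp

text \<open>The exponent per vertex is
  \<open>1 + ln (C + \<alpha> n) - (C - \<alpha> n) * (1 - r / n)\<close>, a perturbation of
  \<open>- (C - 1 - ln C)\<close>. The slack up to \<open>- d\<close> absorbs it uniformly in
  \<open>r \<le> \<epsilon> * n\<close>.\<close>

lemma mean_decay:
  assumes "d < C - 1 - ln C"
  obtains \<epsilon>1 where "0 < \<epsilon>1" "\<And>\<epsilon>. \<epsilon> < \<epsilon>1 \<Longrightarrow> eventually (\<lambda>n. \<forall>r. 0 < r \<and> real r \<le> \<epsilon> * real n \<longrightarrow>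
    mean_card n {r} \<le> real n * exp (- d) ^ r) sequentially"
proof
  \<comment> \<open>Half of the slack pays for \<open>C * \<epsilon>\<close>. A quarter each pays
    for the error \<open>\<alpha> n\<close> in the logarithm and the one in
    \<open>C - \<alpha> n\<close>.\<close>
  define gap where "gap = C - 1 - ln C - d"
  show "0 < min 1 (gap / (2 * C))" using assms C_gt by (simp add: gap_def)
  fix \<epsilon> assume eps: "\<epsilon> < min 1 (gap / (2 * C))"
  then have e1: "\<epsilon> < 1" and "\<epsilon> < gap / (2 * C)" by auto
  then have e2: "C * \<epsilon> \<le> gap / 2" using C_gt by (simp add: field_simps)
  have "eventually (\<lambda>n. \<alpha> n < gap / 4) sequentially"
    using order_tendstoD(2)[OF alpha_lim, of "gap / 4"] assms by (simp add: gap_def)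
  moreover have "eventually (\<lambda>n. \<alpha> n < C) sequentially" using order_tendstoD(2)[OF alpha_lim, of C] C_gt by simp
  ultimately show "eventually (\<lambda>n. \<forall>r. 0 < r \<and> real r \<le> \<epsilon> * real n \<longrightarrow>
    mean_card n {r} \<le> real n * exp (- d) ^ r) sequentially"
    using eventually_near_uniform
  proof eventually_elim
    case (elim n)
    then interpret near_uniform_graph n "p n" "lo n" "hi n" by simp
    have n: "0 < n" using elim by simp
    show ?case
    proof (intro allI impI, elim conjE)
      fix r assume r: "0 < r" "real r \<le> \<epsilon> * real n"
      have "\<epsilon> * real n \<le> real n" using e1 n by simp
      then have rn: "r \<le> n" using r by linarith
      \<comment> \<open>Negative values of \<epsilon> are not excluded by the statement, but they
        admit no positive \<open>r\<close>.\<close>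
      have eps0: "0 \<le> \<epsilon>"
      proof (rule ccontr)
        assume "\<not> 0 \<le> \<epsilon>"
        then have "\<epsilon> * real n \<le> 0" by (simp add: mult_nonpos_nonneg)
        then show False using r by simp
      qed
      let ?ex = "exp (- (C - \<alpha> n) * (real r * (1 - real r / real n)))"
      have lo_eq: "- lo n * real (r * (n - r)) = - (C - \<alpha> n) * (real r * (1 - real r / real n))"
        by (rule lo_exponent[OF rn n])
      have pw: "real n ^ r = real n * real n ^ (r - 1)" using r by (simp add: power_eq_if)
      have "mean_card n {r} \<le>
        real r * real (n choose r) * (real (T r) * hi n ^ (r - 1) * exp (- lo n * real (r * (n - r))))"
        by (rule expct_card_in_single_le[OF r(1)])
      also have "\<dots> = (real r * real (T r)) * real (n choose r) * (hi n ^ (r - 1) * ?ex)"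
        unfolding lo_eq by (simp only: mult_ac)
      also have "\<dots> \<le> (exp (real r) * fact r) * real (n choose r) * (hi n ^ (r - 1) * ?ex)"
        using T_le_exp[OF r(1)] hi_nonneg by (intro mult_right_mono mult_nonneg_nonneg) auto
      also have "\<dots> = exp (real r) * (real (n choose r) * fact r) * (hi n ^ (r - 1) * ?ex)"
        by (simp add: mult_ac)
      also have "\<dots> \<le> exp (real r) * real n ^ r * (hi n ^ (r - 1) * ?ex)"
        using binomial_fact_le[of n r] hi_nonneg
        by (intro mult_right_mono mult_left_mono mult_nonneg_nonneg) auto
      also have "\<dots> = real n * (exp (real r) * (C + \<alpha> n) ^ (r - 1) * ?ex)"
        unfolding pw using n by (simp add: power_divide)
      also have "\<dots> \<le> real n * (exp (real r) * exp (real r * ln (C + \<alpha> n)) * ?ex)"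
        using power_pred_le_exp[of "C + \<alpha> n" r] C_gt alpha_nonneg[of n]
        by (intro mult_left_mono mult_right_mono) auto
      also have "exp (real r) * exp (real r * ln (C + \<alpha> n)) * ?ex =
        exp (real r * (1 + ln (C + \<alpha> n) - (C - \<alpha> n) * (1 - real r / real n)))"
      proof -
        have "exp y * exp (y * l) * exp (- c * (y * u)) = exp (y * (1 + l - c * u))" for y l c u :: real
          by (simp add: algebra_simps flip: exp_add)
        then show ?thesis .
      qed
      also have "\<dots> \<le> exp (real r * (- d))"
      proof -
        have "0 < 1 + \<alpha> n / C" using C_gt alpha_nonneg[of n] by (intro add_pos_nonneg) auto
        then have "ln (C * (1 + \<alpha> n / C)) = ln C + ln (1 + \<alpha> n / C)"
          using C_gt by (intro ln_mult_pos) auto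
        moreover have "C * (1 + \<alpha> n / C) = C + \<alpha> n" using C_gt by (simp add: field_simps)
        ultimately have "ln (C + \<alpha> n) = ln C + ln (1 + \<alpha> n / C)" by simp
        also have "ln (1 + \<alpha> n / C) \<le> \<alpha> n / C"
          using C_gt alpha_nonneg[of n] by (intro ln_add_one_self_le_self) auto
        also have "\<alpha> n / C \<le> \<alpha> n" using mult_left_mono[of 1 C "\<alpha> n"] C_gt alpha_nonneg[of n] by (simp add: divide_le_eq)
        finally have 1: "ln (C + \<alpha> n) \<le> ln C + \<alpha> n" by simp
        have "real r / real n \<le> \<epsilon>" using r n by (simp add: divide_le_eq)
        then have "(C - \<alpha> n) * (1 - \<epsilon>) \<le> (C - \<alpha> n) * (1 - real r / real n)"
          using elim by (intro mult_left_mono) auto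
        moreover have "C - \<alpha> n - C * \<epsilon> \<le> (C - \<alpha> n) * (1 - \<epsilon>)"
          using alpha_nonneg[of n] eps0 by (simp add: algebra_simps)
        ultimately have 2: "C - \<alpha> n - C * \<epsilon> \<le> (C - \<alpha> n) * (1 - real r / real n)" by linarith
        have "1 + ln (C + \<alpha> n) - w \<le> - d" if "C - \<alpha> n - C * \<epsilon> \<le> w" for w
          using that 1 e2 elim(1) unfolding gap_def by argo
        then have "1 + ln (C + \<alpha> n) - (C - \<alpha> n) * (1 - real r / real n) \<le> - d" using 2 by blast
        then have "real r * (1 + ln (C + \<alpha> n) - (C - \<alpha> n) * (1 - real r / real n)) \<le> real r * (- d)"
          by (rule mult_left_mono) simp
        then show ?thesis by (simp only: exp_le_cancel_iff)
      qed
      also have "exp (real r * (- d)) = exp (- d) ^ r" by (rule exp_of_nat_mult)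
      finally show "mean_card n {r} \<le> real n * exp (- d) ^ r" using n by (simp add: mult_left_mono)
    qed
  qed
qed

text \<open>The sizes in the window start at the ceiling of \<open>k\<close>, so the decay gives a
  geometric tail. The real threshold \<open>k\<close> allows both \<open>K\<close> and
  \<open>M * ln n\<close>; \<open>0 \<le> k\<close> keeps the sizes positive.\<close>

lemma mean_tail_le:
  assumes "near_uniform_graph n (p n) (lo n) (hi n)" "0 < d" "0 \<le> k"
    and decay: "\<forall>r. 0 < r \<and> real r \<le> \<epsilon> * real n \<longrightarrow> mean_card n {r} \<le> real n * exp (- d) ^ r"
  shows "mean_card n {r. k < real r \<and> real r \<le> \<epsilon> * real n} \<le> real n * (exp (- d * k) / (1 - exp (- d)))"
proof -
  interpret near_uniform_graph n "p n" "lo n" "hi n" by (rule assms(1))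
  let ?R = "{r. k < real r \<and> real r \<le> \<epsilon> * real n}"
  have "?R \<subseteq> {..nat \<lceil>\<epsilon> * real n\<rceil>}" by (auto, linarith)
  then have fin: "finite ?R" using finite_subset by blast
  have "mean_card n ?R = (\<Sum>r\<in>?R. mean_card n {r})" by (rule expct_card_in_split[OF fin])
  also have "\<dots> \<le> (\<Sum>r\<in>?R. real n * exp (- d) ^ r)"
    using decay assms(3) by (intro sum_mono) auto
  also have "\<dots> = real n * (\<Sum>r\<in>?R. exp (- d) ^ r)" by (simp add: sum_distrib_left)
  also have "(\<Sum>r\<in>?R. exp (- d) ^ r) \<le> exp (- d) ^ nat \<lceil>k\<rceil> / (1 - exp (- d))"
  proof (rule geometric_tail_le[OF _ _ fin])
    fix r assume "r \<in> ?R"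
    then show "nat \<lceil>k\<rceil> \<le> r" by (simp add: ceiling_le_iff nat_le_iff)
  qed (use assms in auto)
  also have "exp (- d) ^ nat \<lceil>k\<rceil> \<le> exp (- d * k)"
  proof -
    have "k \<le> real (nat \<lceil>k\<rceil>)" by linarith
    then have "- d * real (nat \<lceil>k\<rceil>) \<le> - d * k" using assms(2) by simp
    then show ?thesis by (simp only: exp_of_nat2_mult[symmetric] exp_le_cancel_iff)
  qed
  finally show ?thesis using assms(2) by (simp add: mult_left_mono divide_right_mono)
qed

end

section \<open>Combining the estimates\<close>

lemma card_decomposition:
  assumes S: "S \<subseteq> Kn_edges n" and K: "real K \<le> \<epsilon> * real n"
  shows "real n = real (Y n \<epsilon> S) + real (card_in n {r. real K < real r \<and> real r \<le> \<epsilon> * real n} S) +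
    real (card_in n {1..K} S)"
proof -
  let ?f = "\<lambda>i. card (component S i)"
  let ?A = "{i \<in> {1..n}. real (?f i) > \<epsilon> * real n}"
  let ?B = "{i \<in> {1..n}. ?f i \<in> {r. real K < real r \<and> real r \<le> \<epsilon> * real n}}"
  let ?D = "{i \<in> {1..n}. ?f i \<in> {1..K}}"
  have pos: "1 \<le> ?f i" if "i \<in> {1..n}" for i
  proof -
    have "finite (component S i)" using component_subset[OF S that] finite_subset by blast
    then have "0 < ?f i" using self_in_component[of i S] by (auto simp: card_gt_0_iff)
    then show ?thesis by simp
  qed
  \<comment> \<open>Large, intermediate and small components exhaust the vertices, as every
    component has at least one vertex. The hypothesis \<open>K\<close> keeps the large and small
    classes disjoint.\<close>
  have "{1..n} = ?A \<union> ?B \<union> ?D" using pos by fastforce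
  then have "card {1..n} = card (?A \<union> ?B \<union> ?D)" by (rule arg_cong)
  also have "\<dots> = card (?A \<union> ?B) + card ?D" using K by (intro card_Un_disjoint) auto
  also have "card (?A \<union> ?B) = card ?A + card ?B" by (intro card_Un_disjoint) auto
  finally have "n = card ?A + card ?B + card ?D" by simp
  then show ?thesis unfolding Y_def card_in_def by linarith
qed

text \<open>Markov's inequality for the first two error terms and Chebyshev's for the third.\<close>
lemma not_H2_le:
  fixes \<eta> :: real
  assumes S: "S \<subseteq> Kn_edges n" and n: "0 < n" and K: "real K \<le> \<epsilon> * real n"
    and eta: "0 < \<eta>" "4 * \<eta> \<le> \<gamma>" and Q: "\<bar>Q - q C\<bar> \<le> \<eta>"
  shows "1 - of_bool (H2 n C \<gamma> M \<epsilon> S) \<le>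
    real (card_in n {r. M * ln (real n) < real r \<and> real r \<le> \<epsilon> * real n} S) +
    1 / (\<eta> * real n) * real (card_in n {r. real K < real r \<and> real r \<le> \<epsilon> * real n} S) +
    1 / \<eta>\<^sup>2 * (real (card_in n {1..K} S) / real n - Q)\<^sup>2"
    (is "_ \<le> ?A + 1 / (\<eta> * real n) * ?B + 1 / \<eta>\<^sup>2 * (?D / real n - Q)\<^sup>2")
\<comment> \<open>If the inequality fails, then \<open>H2\<close> is false and the left side is 1,
  so each of the three nonnegative summands is below 1.\<close>
proof (rule ccontr)
  assume neg: "\<not> ?thesis"
  have pos: "0 \<le> ?A" "0 \<le> 1 / (\<eta> * real n) * ?B" "0 \<le> 1 / \<eta>\<^sup>2 * (?D / real n - Q)\<^sup>2"
    using eta by auto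
  have notH: "\<not> H2 n C \<gamma> M \<epsilon> S" using neg pos by (cases "H2 n C \<gamma> M \<epsilon> S") auto
  then have less: "?A < 1" "1 / (\<eta> * real n) * ?B < 1" "1 / \<eta>\<^sup>2 * (?D / real n - Q)\<^sup>2 < 1"
    using neg pos by (simp_all only: of_bool_eq)
  \<comment> \<open>A count below 1 is 0, so no component has its size in the forbidden
    window.\<close>
  have "?A = 0" using less(1) by simp
  then have "{i \<in> {1..n}. card (component S i) \<in> {r. M * ln (real n) < real r \<and> real r \<le> \<epsilon> * real n}} = {}"
    by (simp add: card_in_def)
  then have gap: "\<forall>j\<in>{1..n}. real (card (component S j)) \<le> M * ln (real n)
                  \<or> real (card (component S j)) > \<epsilon> * real n" by fastforce
  have B: "?B < \<eta> * real n" using less(2) eta n by (simp add: field_simps)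
  have "(?D / real n - Q)\<^sup>2 < \<eta>\<^sup>2" using less(3) eta by (simp add: field_simps)
  then have "\<bar>?D / real n - Q\<bar> < \<eta>" using eta by (metis abs_of_pos power2_less_imp_less power2_abs abs_ge_zero less_imp_le)
  then have "\<bar>?D / real n - q C\<bar> < 2 * \<eta>" using Q by linarith
  then have "?D / real n < q C + 2 * \<eta>" "q C - 2 * \<eta> < ?D / real n" by linarith+
  then have D: "?D < (q C + 2 * \<eta>) * real n" "(q C - 2 * \<eta>) * real n < ?D"
    using n by (simp_all add: pos_divide_less_eq pos_less_divide_eq)
  have "4 * \<eta> * real n \<le> \<gamma> * real n" "0 < \<eta> * real n" "0 \<le> ?B" using eta n by auto
  \<comment> \<open>The intermediate class has fewer than \<open>\<eta> * n\<close> vertices and the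
    small class is within \<open>2 * \<eta> * n\<close> of \<open>q C * n\<close>; together this
    stays below \<open>\<gamma> * n\<close>.\<close>
  then have "(1 - q C - \<gamma>) * real n \<le> real (Y n \<epsilon> S)" "real (Y n \<epsilon> S) \<le> (1 - q C + \<gamma>) * real n"
    using card_decomposition[OF S K] B D by (auto simp: algebra_simps)
  then show False using notH gap by (simp add: H2_def)
qed

theorem theorem4:
  fixes C M \<gamma> :: real and \<alpha> :: "nat \<Rightarrow> real" and p :: "nat \<Rightarrow> nat set \<Rightarrow> real"
  assumes C_gt: "C > 1"
    and alpha_nonneg: "\<And>n. \<alpha> n \<ge> 0"
    and alpha_lim: "\<alpha> \<longlonglongrightarrow> 0"
    and p_prob: "\<And>n e. e \<in> Kn_edges n \<Longrightarrow> 0 \<le> p n e \<and> p n e \<le> 1"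
    and p_bounds: "\<And>n e. e \<in> Kn_edges n \<Longrightarrow>
                     (C - \<alpha> n) / real n \<le> p n e \<and> p n e \<le> (C + \<alpha> n) / real n"
    and M_gt: "M > 1 / (C - 1 - ln C)"
    and gamma: "0 < \<gamma>" "\<gamma> < 1"
  shows "\<exists>\<epsilon>1>0. \<forall>\<epsilon>. 0 < \<epsilon> \<and> \<epsilon> < \<epsilon>1 \<longrightarrow>
           (\<exists>L3>0. \<forall>n. real n \<ge> L3 \<longrightarrow> prob_graph n (p n) (H2 n C \<gamma> M \<epsilon>) \<ge> 1 - \<gamma>)"
proof -
  interpret sparse_graphs C \<alpha> p
    using assms by (intro sparse_graphs.intro)
  have rate: "0 < C - 1 - ln C" using decay_rate_pos[OF C_gt] .
  have "0 < 1 / (C - 1 - ln C)" using rate by simp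
  then have M: "0 < M" using M_gt by linarith
  then have "1 / M < C - 1 - ln C" using M_gt rate by (simp add: field_simps)
  \<comment> \<open>The rate \<open>d\<close> must lie below \<open>C - 1 - ln C\<close> for the
    decay, and above \<open>1 / M\<close> so that \<open>n * exp (- d * M * ln n)\<close> tends to
    0.\<close>
  then obtain d where d: "1 / M < d" "d < C - 1 - ln C" using dense by blast
  have d0: "0 < d" using d(1) M by (meson divide_pos_pos less_trans zero_less_one)
  have Md: "1 < d * M" using d(1) M by (simp add: field_simps)
  obtain \<epsilon>1 where e1: "0 < \<epsilon>1" "\<And>\<epsilon>. \<epsilon> < \<epsilon>1 \<Longrightarrow>
    eventually (\<lambda>n. \<forall>r. 0 < r \<and> real r \<le> \<epsilon> * real n \<longrightarrow> mean_card n {r} \<le> real n * exp (- d) ^ r) sequentially"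
    using mean_decay[OF d(2)] by blast
  define \<eta> where "\<eta> = \<gamma> / 4"
  have eta: "0 < \<eta>" "4 * \<eta> \<le> \<gamma>" using gamma by (auto simp: \<eta>_def)
  define x where "x = exp (- d)"
  have x: "0 < x" "x < 1" using d0 by (auto simp: x_def)
  define Q where "Q K = (\<Sum>r=1..K. tree_term C r)" for K
  have "eventually (\<lambda>K. dist (Q K) (q C) < \<eta>) sequentially"
    unfolding Q_def using tree_term_sums[OF C_gt] eta by (intro tendstoD)
  moreover have "eventually (\<lambda>K. x ^ K / (1 - x) / \<eta> < \<gamma> / 3) sequentially"
  proof (rule order_tendstoD(2))
    show "(\<lambda>K. x ^ K / (1 - x) / \<eta>) \<longlonglongrightarrow> 0 / (1 - x) / \<eta>"
      using x eta by (intro tendsto_intros LIMSEQ_realpow_zero) auto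
  qed (use gamma in auto)
  ultimately have "eventually (\<lambda>K. dist (Q K) (q C) < \<eta> \<and> x ^ K / (1 - x) / \<eta> < \<gamma> / 3) sequentially"
    by (rule eventually_conj)
  \<comment> \<open>\<open>K\<close> serves two purposes: the partial sum is close to
    \<open>q C\<close>, and Markov's bound for the sizes between \<open>K\<close> and
    \<open>\<epsilon> * n\<close> is small. It is fixed before \<epsilon> and
    \<open>n\<close>.\<close>
  then obtain K where K: "dist (Q K) (q C) < \<eta>" "x ^ K / (1 - x) / \<eta> < \<gamma> / 3"
    by (auto simp: eventually_sequentially)
  have QK: "\<bar>Q K - q C\<bar> \<le> \<eta>" using K(1) by (simp add: dist_real_def)
  show ?thesis
  proof (rule exI[of _ \<epsilon>1], intro conjI allI impI e1(1))
    fix \<epsilon> assume "0 < \<epsilon> \<and> \<epsilon> < \<epsilon>1"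
    then have eps: "0 < \<epsilon>" "\<epsilon> < \<epsilon>1" by auto
    have "filterlim (\<lambda>n. \<epsilon> * real n) at_top sequentially"
      using eps by (intro filterlim_tendsto_pos_mult_at_top[OF tendsto_const] filterlim_real_sequentially)
    then have ev1: "eventually (\<lambda>n. real K \<le> \<epsilon> * real n) sequentially"
      by (simp add: filterlim_at_top)
    have "(\<lambda>n. 1 / \<eta>\<^sup>2 * expct (Kn_edges n) (p n) (\<lambda>S. (real (card_in n {1..K} S) / real n - Q K)\<^sup>2))
      \<longlonglongrightarrow> 1 / \<eta>\<^sup>2 * 0"
      unfolding Q_def by (intro tendsto_intros mean_square_lim)
    then have ev2: "eventually (\<lambda>n. 1 / \<eta>\<^sup>2 *
        expct (Kn_edges n) (p n) (\<lambda>S. (real (card_in n {1..K} S) / real n - Q K)\<^sup>2) < \<gamma> / 3) sequentially"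
      using gamma by (intro order_tendstoD) auto
    \<comment> \<open>The bound equals \<open>n powr (1 - d * M)\<close> up to a constant factor,
      and \<open>d * M > 1\<close>.\<close>
    have ev3: "eventually (\<lambda>n. real n * (exp (- d * (M * ln (real n))) / (1 - exp (- d))) < \<gamma> / 3) sequentially"
    proof (rule order_tendstoD(2))
      have "(\<lambda>n. real n powr (1 - d * M) / (1 - x)) \<longlonglongrightarrow> 0 / (1 - x)"
        using Md x by (intro tendsto_intros tendsto_neg_powr filterlim_real_sequentially) auto
      moreover have "eventually (\<lambda>n. real n powr (1 - d * M) / (1 - x) =
          real n * (exp (- d * (M * ln (real n))) / (1 - exp (- d)))) sequentially"
        using eventually_gt_at_top[of 0]
        by eventually_elim (simp add: x_def powr_diff, simp add: powr_def exp_minus field_simps)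
      ultimately show "(\<lambda>n. real n * (exp (- d * (M * ln (real n))) / (1 - exp (- d)))) \<longlonglongrightarrow> 0 / (1 - x)"
        by (rule Lim_transform_eventually)
    qed (use gamma in auto)
    have "eventually (\<lambda>n. prob_graph n (p n) (H2 n C \<gamma> M \<epsilon>) \<ge> 1 - \<gamma>) sequentially"
      using ev1 ev2 ev3 e1(2)[OF eps(2)] eventually_near_uniform
    proof eventually_elim
      case (elim n)
      then interpret G: near_uniform_graph n "p n" "lo n" "hi n" by simp
      have n: "0 < n" using elim by simp
      let ?E = "expct (Kn_edges n) (p n)"
      let ?R = "{r. M * ln (real n) < real r \<and> real r \<le> \<epsilon> * real n}"
      let ?S = "{r. real K < real r \<and> real r \<le> \<epsilon> * real n}"
      have "1 - prob_graph n (p n) (H2 n C \<gamma> M \<epsilon>) = ?E (\<lambda>S. 1 - of_bool (H2 n C \<gamma> M \<epsilon> S))"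
        by (simp add: prob_graph_eq_expct finite_Kn_edges expct_diff expct_one)
      also have "\<dots> \<le> ?E (\<lambda>S. real (card_in n ?R S) + 1 / (\<eta> * real n) * real (card_in n ?S S) +
          1 / \<eta>\<^sup>2 * (real (card_in n {1..K} S) / real n - Q K)\<^sup>2)"
        using elim G.p_range QK eta n by (intro expct_mono not_H2_le) auto
      also have "\<dots> = mean_card n ?R + 1 / (\<eta> * real n) * mean_card n ?S +
          1 / \<eta>\<^sup>2 * ?E (\<lambda>S. (real (card_in n {1..K} S) / real n - Q K)\<^sup>2)"
        unfolding expct_add expct_cmult ..
      \<comment> \<open>One third of \<gamma> each for the forbidden window, the intermediate sizes
        and the fluctuation of the small ones.\<close>
      also have "\<dots> \<le> \<gamma> / 3 + \<gamma> / 3 + \<gamma> / 3"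
      proof (intro add_mono)
        have "mean_card n ?R \<le> real n * (exp (- d * (M * ln (real n))) / (1 - exp (- d)))"
          using elim n M by (intro mean_tail_le[OF _ d0]) auto
        then show "mean_card n ?R \<le> \<gamma> / 3" using elim by linarith
        have "mean_card n ?S \<le> real n * (exp (- d * real K) / (1 - exp (- d)))"
          using elim n by (intro mean_tail_le[OF _ d0]) auto
        also have "\<dots> = real n * (x ^ K / (1 - x))" by (simp only: x_def exp_of_nat2_mult)
        finally have "1 / (\<eta> * real n) * mean_card n ?S \<le> 1 / (\<eta> * real n) * (real n * (x ^ K / (1 - x)))"
          using eta by (intro mult_left_mono) auto
        also have "\<dots> = x ^ K / (1 - x) / \<eta>" using n by simp
        finally show "1 / (\<eta> * real n) * mean_card n ?S \<le> \<gamma> / 3" using K(2) by linarith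
        show "1 / \<eta>\<^sup>2 * ?E (\<lambda>S. (real (card_in n {1..K} S) / real n - Q K)\<^sup>2) \<le> \<gamma> / 3"
          using elim by linarith
      qed
      finally show ?case by simp
    qed
    then obtain N where N: "\<And>n. n \<ge> N \<Longrightarrow> prob_graph n (p n) (H2 n C \<gamma> M \<epsilon>) \<ge> 1 - \<gamma>"
      by (auto simp: eventually_sequentially)
    show "\<exists>L3>0. \<forall>n. real n \<ge> L3 \<longrightarrow> prob_graph n (p n) (H2 n C \<gamma> M \<epsilon>) \<ge> 1 - \<gamma>"
      \<comment> \<open>\<open>Suc N\<close> ensures that the threshold is positive.\<close>
      using N by (intro exI[of _ "real (Suc N)"]) auto
  qed
qed

end
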